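(* Let $(R,\mathfrak{m})$ be a one-dimensional Cohen-Macaulay local ring. Let $I$ and $J$ be ideals of $R$ such that $I$ is $\mathfrak{m}$-primary and $IJ\subseteq xR$ for some nonzerodivisor $x\in\mathfrak{m}$. If $x\in J\mathfrak{m}$, then $I$ is Elias.
   Context: Local rings are commutative and Noetherian. For a finitely generated $R$-module $M$ over a local ring $(R,\mathfrak{m},k)$, $\operatorname{type}_R(M):=\dim_k\operatorname{Ext}_R^{\dim_R M}(k,M)$. An $\mathfrak{m}$-primary ideal $I$ of a one-dimensional Cohen-Macaulay local ring $R$ is Elias if $\operatorname{type}_R(I)=\operatorname{type}_R(R/I)$. *)

theory Defs
  imports
    "HOL-Algebra.Algebra"
    "HOL-Library.Extended_Nat"
    "Jordan_Normal_Form.Missing_VectorSpace"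
begin

section \<open>Local rings, dimension, depth\<close>

locale noetherian_local_ring = cring R + noetherian_ring R for R (structure) +
  fixes \<mm> :: "'a set"
  assumes maximal: "maximalideal \<mm> R"
    and unique_maximal: "\<And>\<nn>. maximalideal \<nn> R \<Longrightarrow> \<nn> = \<mm>"

definition nonzerodivisor :: "('a, 'b) ring_scheme \<Rightarrow> 'a \<Rightarrow> bool" where
  "nonzerodivisor R x \<longleftrightarrow>
     x \<in> carrier R \<and> (\<forall>y \<in> carrier R. x \<otimes>\<^bsub>R\<^esub> y = \<zero>\<^bsub>R\<^esub> \<longrightarrow> y = \<zero>\<^bsub>R\<^esub>)"

text \<open>Supremum of the lengths \<open>n\<close> of chains \<open>P 0 \<subset> \<dots> \<subset> P n\<close> of prime ideals;
  the zero ring gets dimension \<open>0\<close>.\<close>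
definition krull_dim :: "('a, 'b) ring_scheme \<Rightarrow> enat" where
  "krull_dim R = Sup {enat n | n. \<exists>P :: nat \<Rightarrow> 'a set.
     (\<forall>i \<le> n. primeideal (P i) R) \<and> (\<forall>i < n. P i \<subset> P (Suc i))}"

definition regular_sequence :: "('a, 'b) ring_scheme \<Rightarrow> 'a list \<Rightarrow> bool" where
  "regular_sequence R xs \<longleftrightarrow>
     set xs \<subseteq> carrier R \<and>
     (\<forall>i < length xs.
        nonzerodivisor (R Quot (Idl\<^bsub>R\<^esub> (set (take i xs))))
                       (Idl\<^bsub>R\<^esub> (set (take i xs)) +>\<^bsub>R\<^esub> (xs ! i))) \<and>
     Idl\<^bsub>R\<^esub> (set xs) \<noteq> carrier R"

definition depth :: "('a, 'b) ring_scheme \<Rightarrow> 'a set \<Rightarrow> enat" where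
  "depth R \<mm> = Sup {enat (length xs) | xs. set xs \<subseteq> \<mm> \<and> regular_sequence R xs}"

text \<open>For a Noetherian local ring \<open>(R, \<mm>)\<close>.\<close>
definition cohen_macaulay :: "('a, 'b) ring_scheme \<Rightarrow> 'a set \<Rightarrow> bool" where
  "cohen_macaulay R \<mm> \<longleftrightarrow> depth R \<mm> = krull_dim R"

definition radical :: "('a, 'b) ring_scheme \<Rightarrow> 'a set \<Rightarrow> 'a set" where
  "radical R Q = {r \<in> carrier R. \<exists>n :: nat. r [^]\<^bsub>R\<^esub> n \<in> Q}"

definition primary_ideal :: "('a, 'b) ring_scheme \<Rightarrow> 'a set \<Rightarrow> bool" where
  "primary_ideal R Q \<longleftrightarrow>
     ideal Q R \<and> Q \<noteq> carrier R \<and>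
     (\<forall>a \<in> carrier R. \<forall>b \<in> carrier R.
        a \<otimes>\<^bsub>R\<^esub> b \<in> Q \<longrightarrow> a \<in> Q \<or> (\<exists>n :: nat. b [^]\<^bsub>R\<^esub> n \<in> Q))"

text \<open>\<open>Q\<close> is \<open>P\<close>-primary.\<close>
definition primary_to :: "('a, 'b) ring_scheme \<Rightarrow> 'a set \<Rightarrow> 'a set \<Rightarrow> bool" where
  "primary_to R P Q \<longleftrightarrow> primary_ideal R Q \<and> radical R Q = P"


section \<open>Modules\<close>

text \<open>Module records extend ring records; the fields \<open>mult\<close> and \<open>one\<close> of a module play no role
  and are filled arbitrarily.\<close>

definition regular_module :: "('a, 'b) ring_scheme \<Rightarrow> ('a, 'a) module" where
  "regular_module R =
     \<lparr>carrier = carrier R, monoid.mult = monoid.mult R, one = \<one>\<^bsub>R\<^esub>,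
      ring.zero = \<zero>\<^bsub>R\<^esub>, add = add R, smult = monoid.mult R\<rparr>"

definition ideal_module :: "('a, 'b) ring_scheme \<Rightarrow> 'a set \<Rightarrow> ('a, 'a) module" where
  "ideal_module R I = (regular_module R)\<lparr>carrier := I\<rparr>"

definition quotient_module :: "('a, 'c) module \<Rightarrow> 'c set \<Rightarrow> ('a, 'c set) module" where
  "quotient_module M H =
     \<lparr>carrier = a_rcosets\<^bsub>M\<^esub> H, monoid.mult = (\<lambda>_ _. H), one = H, ring.zero = H, add = set_add M,
      smult = (\<lambda>r A. \<Union>v \<in> A. H +>\<^bsub>M\<^esub> (r \<odot>\<^bsub>M\<^esub> v))\<rparr>"

definition annihilator :: "('a, 'b) ring_scheme \<Rightarrow> ('a, 'c) module \<Rightarrow> 'a set" where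
  "annihilator R M = {r \<in> carrier R. \<forall>v \<in> carrier M. r \<odot>\<^bsub>M\<^esub> v = \<zero>\<^bsub>M\<^esub>}"

definition module_dim :: "('a, 'b) ring_scheme \<Rightarrow> ('a, 'c) module \<Rightarrow> enat" where
  "module_dim R M = krull_dim (R Quot (annihilator R M))"

text \<open>The module of \<open>R\<close>-linear maps; maps are made extensional so that equality of elements is
  equality of maps on \<open>carrier M\<close>.\<close>
definition Hom_module ::
    "('a, 'b) ring_scheme \<Rightarrow> ('a, 'c) module \<Rightarrow> ('a, 'd) module \<Rightarrow> ('a, 'c \<Rightarrow> 'd) module" where
  "Hom_module R M N =
     \<lparr>carrier = module_hom R M N \<inter> extensional (carrier M),
      monoid.mult = (\<lambda>_ _. restrict (\<lambda>_. \<zero>\<^bsub>N\<^esub>) (carrier M)),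
      one = restrict (\<lambda>_. \<zero>\<^bsub>N\<^esub>) (carrier M),
      ring.zero = restrict (\<lambda>_. \<zero>\<^bsub>N\<^esub>) (carrier M),
      add = (\<lambda>f g. restrict (\<lambda>v. f v \<oplus>\<^bsub>N\<^esub> g v) (carrier M)),
      smult = (\<lambda>r f. restrict (\<lambda>v. r \<odot>\<^bsub>N\<^esub> f v) (carrier M))\<rparr>"


section \<open>Ext\<close>

abbreviation free_module :: "('a, 'b) ring_scheme \<Rightarrow> nat \<Rightarrow> ('a, nat \<Rightarrow> 'a) module" where
  "free_module R n \<equiv> ring.func_space R {..<n}"

text \<open>\<open>\<dots> \<rightarrow> R^(b 2) \<rightarrow> R^(b 1) \<rightarrow> R^(b 0) \<rightarrow> N \<rightarrow> 0\<close> is exact, where the map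
  \<open>R^(b (i + 1)) \<rightarrow> R^(b i)\<close> is \<open>d i\<close> and the map \<open>R^(b 0) \<rightarrow> N\<close> is \<open>e\<close>.\<close>
definition free_resolution ::
    "('a, 'b) ring_scheme \<Rightarrow> ('a, 'c) module \<Rightarrow> (nat \<Rightarrow> nat) \<Rightarrow>
     (nat \<Rightarrow> (nat \<Rightarrow> 'a) \<Rightarrow> (nat \<Rightarrow> 'a)) \<Rightarrow> ((nat \<Rightarrow> 'a) \<Rightarrow> 'c) \<Rightarrow> bool" where
  "free_resolution R N b d e \<longleftrightarrow>
     e \<in> module_hom R (free_module R (b 0)) N \<and>
     (\<forall>i. d i \<in> module_hom R (free_module R (b (Suc i))) (free_module R (b i))) \<and>
     e ` carrier (free_module R (b 0)) = carrier N \<and>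
     d 0 ` carrier (free_module R (b 1)) =
       {v \<in> carrier (free_module R (b 0)). e v = \<zero>\<^bsub>N\<^esub>} \<and>
     (\<forall>i. d (Suc i) ` carrier (free_module R (b (Suc (Suc i)))) =
       {v \<in> carrier (free_module R (b (Suc i))). d i v = \<zero>\<^bsub>free_module R (b i)\<^esub>})"

text \<open>The cochain complex \<open>Hom(R^(b 0), M) \<rightarrow> Hom(R^(b 1), M) \<rightarrow> \<dots>\<close>, with coboundary maps
  \<open>f \<mapsto> f \<circ> d n\<close>.\<close>

definition cocycles ::
    "('a, 'b) ring_scheme \<Rightarrow> (nat \<Rightarrow> nat) \<Rightarrow> (nat \<Rightarrow> (nat \<Rightarrow> 'a) \<Rightarrow> (nat \<Rightarrow> 'a)) \<Rightarrow>
     ('a, 'c) module \<Rightarrow> nat \<Rightarrow> ((nat \<Rightarrow> 'a) \<Rightarrow> 'c) set" where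
  "cocycles R b d M n =
     {f \<in> carrier (Hom_module R (free_module R (b n)) M).
        compose (carrier (free_module R (b (Suc n)))) f (d n)
          = \<zero>\<^bsub>Hom_module R (free_module R (b (Suc n))) M\<^esub>}"

definition coboundaries ::
    "('a, 'b) ring_scheme \<Rightarrow> (nat \<Rightarrow> nat) \<Rightarrow> (nat \<Rightarrow> (nat \<Rightarrow> 'a) \<Rightarrow> (nat \<Rightarrow> 'a)) \<Rightarrow>
     ('a, 'c) module \<Rightarrow> nat \<Rightarrow> ((nat \<Rightarrow> 'a) \<Rightarrow> 'c) set" where
  "coboundaries R b d M n =
     (case n of
        0 \<Rightarrow> {\<zero>\<^bsub>Hom_module R (free_module R (b 0)) M\<^esub>}
      | Suc j \<Rightarrow> (\<lambda>f. compose (carrier (free_module R (b (Suc j)))) f (d j)) `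
                 carrier (Hom_module R (free_module R (b j)) M))"

definition cohomology ::
    "('a, 'b) ring_scheme \<Rightarrow> (nat \<Rightarrow> nat) \<Rightarrow> (nat \<Rightarrow> (nat \<Rightarrow> 'a) \<Rightarrow> (nat \<Rightarrow> 'a)) \<Rightarrow>
     ('a, 'c) module \<Rightarrow> nat \<Rightarrow> ('a, ((nat \<Rightarrow> 'a) \<Rightarrow> 'c) set) module" where
  "cohomology R b d M n =
     quotient_module ((Hom_module R (free_module R (b n)) M)\<lparr>carrier := cocycles R b d M n\<rparr>)
                     (coboundaries R b d M n)"

text \<open>Ext is computed from a chosen resolution of the first argument by free modules of finite
  rank. It is intended for Noetherian \<open>R\<close> and finitely generated \<open>N\<close>: then such a resolution
  exists, and up to isomorphism the result does not depend on the choice.\<close>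
definition Ext ::
    "('a, 'b) ring_scheme \<Rightarrow> nat \<Rightarrow> ('a, 'c) module \<Rightarrow> ('a, 'd) module \<Rightarrow>
     ('a, ((nat \<Rightarrow> 'a) \<Rightarrow> 'd) set) module" where
  "Ext R n N M =
     (let (b, d) = (SOME (b, d). \<exists>e. free_resolution R N b d e) in cohomology R b d M n)"


section \<open>Type and Elias ideals\<close>

text \<open>An \<open>R\<close>-module annihilated by \<open>\<mm>\<close>, regarded as a vector space over the field \<open>R Quot \<mm>\<close>. A
  residue class acts through any of its representatives.\<close>
definition residue_vectorspace :: "('a, 'c) module \<Rightarrow> ('a set, 'c) module" where
  "residue_vectorspace E =
     \<lparr>carrier = carrier E, monoid.mult = monoid.mult E, one = \<one>\<^bsub>E\<^esub>, ring.zero = \<zero>\<^bsub>E\<^esub>, add = add E,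
      smult = (\<lambda>\<kappa> v. (SOME r. r \<in> \<kappa>) \<odot>\<^bsub>E\<^esub> v)\<rparr>"

text \<open>Intended for finitely generated nonzero \<open>M\<close>, so that the Ext module is a
  finite-dimensional vector space over the residue field;
  \<^const>\<open>vectorspace.dim\<close> is unspecified in infinite dimension.\<close>
definition module_type :: "('a, 'b) ring_scheme \<Rightarrow> 'a set \<Rightarrow> ('a, 'c) module \<Rightarrow> nat" where
  "module_type R \<mm> M =
     vectorspace.dim (R Quot \<mm>)
       (residue_vectorspace
         (Ext R (the_enat (module_dim R M)) (quotient_module (regular_module R) \<mm>) M))"

text \<open>Used only for \<open>\<mm>\<close>-primary ideals of one-dimensional Cohen-Macaulay local rings.\<close>
definition elias_ideal :: "('a, 'b) ring_scheme \<Rightarrow> 'a set \<Rightarrow> 'a set \<Rightarrow> bool" where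
  "elias_ideal R \<mm> I \<longleftrightarrow>
     module_type R \<mm> (ideal_module R I) =
     module_type R \<mm> (quotient_module (regular_module R) I)"

end

theory Submission
  imports Defs
begin

text \<open>
  Write \<open>k\<close> for the residue field. By the dimension computations below, \<open>I\<close> has dimension one and
  \<open>R/I\<close> has dimension zero, so the two types are the dimensions of \<open>Ext\<^sup>1(k, I)\<close> and \<open>Hom(k, R/I)\<close>.
  The sequence \<open>0 \<rightarrow> I \<rightarrow> R \<rightarrow> R/I \<rightarrow> 0\<close> yields a connecting map \<open>Hom(k, R/I) \<rightarrow> Ext\<^sup>1(k, I)\<close>,
  injective because a nonzerodivisor in \<open>\<mm>\<close> forces \<open>Hom(k, R) = 0\<close>. It is surjective exactly when
  \<open>Ext\<^sup>1(k, I) \<rightarrow> Ext\<^sup>1(k, R)\<close> vanishes. Since \<open>Ext\<^sup>1(k, I)\<close> is \<open>(xI :\<^sub>I \<mm>)/xI\<close>, and similarly for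
  \<open>R\<close>, this says that every \<open>y \<in> I\<close> with \<open>y\<mm> \<subseteq> xI\<close> is a multiple of \<open>x\<close>.

  The hypotheses on \<open>J\<close> give precisely that (\<open>mem_multiples_of_colon_multiples\<close>):
  \<open>yx \<in> yJ\<mm> \<subseteq> J\<cdot>xI \<subseteq> x\<^sup>2R\<close>, and \<open>x\<close> cancels.

  The connecting map is made explicit on an arbitrary resolution \<open>\<dots> \<rightarrow> F\<^sub>1 \<rightarrow> F\<^sub>0 \<rightarrow> k\<close> by finite free
  modules. Let \<open>L\<close> be the module of all linear \<open>g : F\<^sub>0 \<rightarrow> R\<close> that map the first syzygies, the image of
  \<open>F\<^sub>1\<close>, into \<open>I\<close>. Reducing \<open>g\<close> modulo \<open>I\<close> gives a zero-cocycle with values in \<open>R/I\<close>, and restricting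
  \<open>g\<close> to the syzygies gives a one-cocycle with values in \<open>I\<close>. Both maps are onto (\<open>reduction_surj\<close>,
  \<open>restriction_surj\<close>), and in both cases the class vanishes if and only if \<open>g\<close> takes all its values in
  \<open>I\<close>. So \<open>L\<close> covers both cohomology modules with the same kernel, and they are isomorphic.

  Since \<open>Ext\<close> is computed from a chosen resolution, one has to know that a resolution exists; this is
  where \<open>R\<close> being Noetherian enters (\<open>exists_free_resolution\<close>).
\<close>

section \<open>Quotients, Hom modules and ideals as modules\<close>

text \<open>The module axioms are equations, so they pass from a module to any surjective image of it. This
  spares checking them on cosets.\<close>

lemma module_surj_image:
  assumes M: "module R M"
    and f: "f \<in> module_hom R M N"
    and surj: "f ` carrier M = carrier N"
    and zero: "f \<zero>\<^bsub>M\<^esub> = \<zero>\<^bsub>N\<^esub>"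
  shows "module R N"
proof -
  interpret M: module R M by (rule M)
  note add = module_hom_add[OF f, symmetric] and smult = module_hom_smult[OF f, symmetric]
  have im: "\<exists>v \<in> carrier M. w = f v" if "w \<in> carrier N" for w
    using that surj by blast
  have cl: "f v \<in> carrier N" if "v \<in> carrier M" for v
    using that surj by blast
  show ?thesis
  proof (rule module_criteria)
    show "cring R" ..
    show "\<zero>\<^bsub>N\<^esub> \<in> carrier N"
      using cl[of "\<zero>\<^bsub>M\<^esub>"] zero by simp
    show "\<forall>v\<in>carrier N. \<exists>w\<in>carrier N. v \<oplus>\<^bsub>N\<^esub> w = \<zero>\<^bsub>N\<^esub>"
    proof
      fix v assume "v \<in> carrier N"
      then obtain u where u: "u \<in> carrier M" "v = f u" using im by blast
      then have "v \<oplus>\<^bsub>N\<^esub> f (\<ominus>\<^bsub>M\<^esub> u) = \<zero>\<^bsub>N\<^esub>"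
        by (simp add: add M.M.r_neg zero)
      then show "\<exists>w\<in>carrier N. v \<oplus>\<^bsub>N\<^esub> w = \<zero>\<^bsub>N\<^esub>"
        using u cl by blast
    qed
    show "\<forall>v w. v \<in> carrier N \<and> w \<in> carrier N \<longrightarrow> v \<oplus>\<^bsub>N\<^esub> w \<in> carrier N"
      by (auto dest!: im simp: add cl)
    show "\<forall>c v. c \<in> carrier R \<and> v \<in> carrier N \<longrightarrow> c \<odot>\<^bsub>N\<^esub> v \<in> carrier N"
      by (auto dest!: im simp: smult cl)
    show "\<forall>v w. v \<in> carrier N \<and> w \<in> carrier N \<longrightarrow> v \<oplus>\<^bsub>N\<^esub> w = w \<oplus>\<^bsub>N\<^esub> v"
      by (auto dest!: im simp: add M.M.a_comm)
    show "\<forall>v w x. v \<in> carrier N \<and> w \<in> carrier N \<and> x \<in> carrier N \<longrightarrow>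
        v \<oplus>\<^bsub>N\<^esub> w \<oplus>\<^bsub>N\<^esub> x = v \<oplus>\<^bsub>N\<^esub> (w \<oplus>\<^bsub>N\<^esub> x)"
      by (auto dest!: im simp: add M.M.a_assoc)
    show "\<forall>v\<in>carrier N. v \<oplus>\<^bsub>N\<^esub> \<zero>\<^bsub>N\<^esub> = v"
      by (auto dest!: im simp: add zero[symmetric])
    show "\<forall>a b v. a \<in> carrier R \<and> b \<in> carrier R \<and> v \<in> carrier N \<longrightarrow>
        (a \<otimes>\<^bsub>R\<^esub> b) \<odot>\<^bsub>N\<^esub> v = a \<odot>\<^bsub>N\<^esub> (b \<odot>\<^bsub>N\<^esub> v)"
      by (auto dest!: im simp: smult M.smult_assoc1)
    show "\<forall>v\<in>carrier N. \<one>\<^bsub>R\<^esub> \<odot>\<^bsub>N\<^esub> v = v"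
      by (auto dest!: im simp: smult)
    show "\<forall>a b v. a \<in> carrier R \<and> b \<in> carrier R \<and> v \<in> carrier N \<longrightarrow>
        (a \<oplus>\<^bsub>R\<^esub> b) \<odot>\<^bsub>N\<^esub> v = a \<odot>\<^bsub>N\<^esub> v \<oplus>\<^bsub>N\<^esub> b \<odot>\<^bsub>N\<^esub> v"
      by (auto dest!: im simp: smult add M.smult_l_distr)
    show "\<forall>a v w. a \<in> carrier R \<and> v \<in> carrier N \<and> w \<in> carrier N \<longrightarrow>
        a \<odot>\<^bsub>N\<^esub> (v \<oplus>\<^bsub>N\<^esub> w) = a \<odot>\<^bsub>N\<^esub> v \<oplus>\<^bsub>N\<^esub> a \<odot>\<^bsub>N\<^esub> w"
      by (auto dest!: im simp: smult add M.smult_r_distr)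
  qed
qed

lemma module_hom_zero:
  assumes "module R M" "module R N" "f \<in> module_hom R M N"
  shows "f \<zero>\<^bsub>M\<^esub> = \<zero>\<^bsub>N\<^esub>"
proof -
  interpret mod_hom R M N f
    using assms by (simp add: mod_hom_def mod_hom_axioms_def)
  show ?thesis by simp
qed

lemma module_hom_minus:
  assumes "module R M" "module R N" "f \<in> module_hom R M N" "v \<in> carrier M" "w \<in> carrier M"
  shows "f (v \<ominus>\<^bsub>M\<^esub> w) = f v \<ominus>\<^bsub>N\<^esub> f w"
proof -
  interpret mod_hom R M N f
    using assms by (simp add: mod_hom_def mod_hom_axioms_def)
  show ?thesis using assms(4,5) by simp
qed

text \<open>Gives access to the library of cosets of additive subgroups.\<close>

lemma abelian_subgroup_of_submodule:
  assumes "submodule R H M"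
  shows "abelian_subgroup H M"
proof -
  interpret submodule R H M by fact
  interpret M: module R M by (rule module)
  have neg: "\<ominus>\<^bsub>M\<^esub> v \<in> H" if "v \<in> H" for v
    using smult_closed[OF M.R.add.inv_closed[OF M.R.one_closed] that] M.smult_minus_1[of v] subset that
    by (metis subsetD)
  have "H \<noteq> {}"
    using zero_closed by blast
  then have "subgroup H (add_monoid M)"
    by (intro M.add.subgroupI) (use subset neg in \<open>auto simp: a_inv_def\<close>)
  then show ?thesis
    by (intro abelian_subgroupI3 additive_subgroup.intro M.M.abelian_group_axioms)
qed

context
  fixes R :: "('a, 'b) ring_scheme" and M :: "('a, 'c) module" and H :: "'c set"
  assumes H: "submodule R H M"
begin

interpretation M: module R M
  using H by (rule submodule.module)

interpretation H: abelian_subgroup H M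
  using H by (rule abelian_subgroup_of_submodule)

lemma carrier_quotient_module:
  "carrier (quotient_module M H) = (\<lambda>v. H +>\<^bsub>M\<^esub> v) ` carrier M"
  by (auto simp: quotient_module_def A_RCOSETS_def')

lemma coset_eq_iff:
  assumes "v \<in> carrier M" "w \<in> carrier M"
  shows "H +>\<^bsub>M\<^esub> v = H +>\<^bsub>M\<^esub> w \<longleftrightarrow> v \<ominus>\<^bsub>M\<^esub> w \<in> H"
  using assms
  by (metis H.a_rcos_module H.a_rcos_self H.a_repr_independence' a_minus_def)

text \<open>The scalar multiplication of the quotient is a union over representatives. The point is that
  all members of this union coincide.\<close>

lemma coset_map_hom: "(\<lambda>v. H +>\<^bsub>M\<^esub> v) \<in> module_hom R M (quotient_module M H)"
proof -
  have "(\<Union>w \<in> H +>\<^bsub>M\<^esub> v. H +>\<^bsub>M\<^esub> (r \<odot>\<^bsub>M\<^esub> w)) = H +>\<^bsub>M\<^esub> (r \<odot>\<^bsub>M\<^esub> v)"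
    if "r \<in> carrier R" "v \<in> carrier M" for r v
  proof -
    have "H +>\<^bsub>M\<^esub> (r \<odot>\<^bsub>M\<^esub> w) = H +>\<^bsub>M\<^esub> (r \<odot>\<^bsub>M\<^esub> v)" if w: "w \<in> H +>\<^bsub>M\<^esub> v" for w
    proof -
      have wM: "w \<in> carrier M"
        using w \<open>v \<in> carrier M\<close> by (rule H.a_elemrcos_carrier[rotated])
      have "w \<ominus>\<^bsub>M\<^esub> v \<in> H"
        using w \<open>v \<in> carrier M\<close> by (simp add: a_minus_def H.a_rcos_module_imp)
      then have "r \<odot>\<^bsub>M\<^esub> (w \<ominus>\<^bsub>M\<^esub> v) \<in> H"
        using H that by (simp add: submodule.smult_closed \<open>r \<in> carrier R\<close>)
      then have "r \<odot>\<^bsub>M\<^esub> w \<ominus>\<^bsub>M\<^esub> r \<odot>\<^bsub>M\<^esub> v \<in> H"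
        using wM \<open>r \<in> carrier R\<close> \<open>v \<in> carrier M\<close>
        by (simp add: a_minus_def M.smult_r_distr M.smult_r_minus)
      then show ?thesis
        using wM \<open>r \<in> carrier R\<close> \<open>v \<in> carrier M\<close> by (simp add: coset_eq_iff)
    qed
    moreover have "v \<in> H +>\<^bsub>M\<^esub> v"
      using that by (simp add: H.a_rcos_self)
    ultimately show ?thesis by blast
  qed
  then show ?thesis
    unfolding module_hom_def
    by (auto simp: carrier_quotient_module) (auto simp: quotient_module_def H.a_rcos_sum)
qed

lemma coset_zero: "H +>\<^bsub>M\<^esub> \<zero>\<^bsub>M\<^esub> = \<zero>\<^bsub>quotient_module M H\<^esub>"
  by (simp add: quotient_module_def H.a_rcos_const)

lemma coset_eq_zero_iff:
  "v \<in> carrier M \<Longrightarrow> H +>\<^bsub>M\<^esub> v = \<zero>\<^bsub>quotient_module M H\<^esub> \<longleftrightarrow> v \<in> H"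
  using M.smult_minus_1[of "\<zero>\<^bsub>M\<^esub>"] by (simp add: coset_eq_iff a_minus_def flip: coset_zero)

lemma quotient_module_is_module: "module R (quotient_module M H)"
  by (rule module_surj_image[OF M.module_axioms coset_map_hom])
    (simp_all add: carrier_quotient_module coset_zero)

end

lemma Hom_module_is_module:
  assumes M: "module R M" and N: "module R N"
  shows "module R (Hom_module R M N)"
proof -
  interpret M: module R M by fact
  interpret N: module R N by fact
  have cl: "f v \<in> carrier N" if "f \<in> module_hom R M N" "v \<in> carrier M" for f v
    using module_hom_closed[OF that(1)] that(2) by blast
  note hom = module_hom_add module_hom_smult
  have add: "restrict (\<lambda>v. f v \<oplus>\<^bsub>N\<^esub> g v) (carrier M) \<in> module_hom R M N"
    if f: "f \<in> module_hom R M N" and g: "g \<in> module_hom R M N" for f g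
    unfolding module_hom_def
    by (auto simp: cl[OF f] cl[OF g] hom[OF f] hom[OF g] N.smult_r_distr N.M.a_ac)
  have smult: "restrict (\<lambda>v. r \<odot>\<^bsub>N\<^esub> f v) (carrier M) \<in> module_hom R M N"
    if f: "f \<in> module_hom R M N" and r: "r \<in> carrier R" for f r
    using r unfolding module_hom_def
    by (auto simp: cl[OF f] hom[OF f] N.smult_r_distr N.smult_assoc_simp M.m_comm)
  show ?thesis
  proof (rule module_criteria)
    show "cring R" ..
    show "\<zero>\<^bsub>Hom_module R M N\<^esub> \<in> carrier (Hom_module R M N)"
      by (auto simp: Hom_module_def module_hom_def)
    show "\<forall>v w. v \<in> carrier (Hom_module R M N) \<and> w \<in> carrier (Hom_module R M N) \<longrightarrow>
       v \<oplus>\<^bsub>Hom_module R M N\<^esub> w \<in> carrier (Hom_module R M N)"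
      by (auto simp: Hom_module_def add)
    show "\<forall>c v. c \<in> carrier R \<and> v \<in> carrier (Hom_module R M N) \<longrightarrow>
       c \<odot>\<^bsub>Hom_module R M N\<^esub> v \<in> carrier (Hom_module R M N)"
      by (auto simp: Hom_module_def smult)
    show "\<forall>v\<in>carrier (Hom_module R M N).
       \<exists>neg_v\<in>carrier (Hom_module R M N). v \<oplus>\<^bsub>Hom_module R M N\<^esub> neg_v = \<zero>\<^bsub>Hom_module R M N\<^esub>"
    proof
      fix f assume "f \<in> carrier (Hom_module R M N)"
      then have f: "f \<in> module_hom R M N" by (simp add: Hom_module_def)
      show "\<exists>g\<in>carrier (Hom_module R M N). f \<oplus>\<^bsub>Hom_module R M N\<^esub> g = \<zero>\<^bsub>Hom_module R M N\<^esub>"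
        using smult[OF f, of "\<ominus>\<^bsub>R\<^esub> \<one>\<^bsub>R\<^esub>"]
        by (intro bexI[of _ "restrict (\<lambda>v. (\<ominus>\<^bsub>R\<^esub> \<one>\<^bsub>R\<^esub>) \<odot>\<^bsub>N\<^esub> f v) (carrier M)"])
          (auto simp: Hom_module_def N.smult_minus_1 cl[OF f] N.M.r_neg intro!: restrict_ext)
    qed
  qed (auto simp: Hom_module_def cl hom N.M.a_ac N.smult_l_distr N.smult_r_distr
        N.smult_assoc1 extensional_def fun_eq_iff restrict_def)
qed

lemma regular_module_is_module:
  assumes "cring R"
  shows "module R (regular_module R)"
proof -
  interpret cring R by fact
  show ?thesis
    by (rule module_criteria)
      (auto simp: regular_module_def a_ac m_assoc l_distr r_distr cring_axioms intro: r_neg a_inv_closed)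
qed

lemma ideal_is_submodule:
  assumes "cring R" "ideal I R"
  shows "submodule R I (regular_module R)"
proof -
  interpret ideal I R by fact
  show ?thesis
    by (rule submodule.intro[OF regular_module_is_module[OF assms(1)]])
      (auto simp: regular_module_def I_l_closed)
qed

lemma ideal_module_is_module:
  assumes "cring R" "ideal I R"
  shows "module R (ideal_module R I)"
  unfolding ideal_module_def
  using ideal_is_submodule[OF assms] regular_module_is_module[OF assms(1)]
  by (rule module.submodule_is_module[rotated])

section \<open>Dimensions over the residue field\<close>

text \<open>In the infinite-dimensional case the two dimensions are the same unspecified number, namely the
  least element of an empty set of naturals.\<close>

lemma dim_eq_of_linear_bij:
  assumes T: "linear_map K V W T" and bij: "bij_betw T (carrier V) (carrier W)"
  shows "vectorspace.dim K V = vectorspace.dim K W"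
proof -
  interpret linear_map K V W T by fact
  have inj: "inj_on T (carrier V)" and surj: "T ` carrier V = carrier W"
    using bij by (auto simp: bij_betw_def)
  define S where "S = inv_into (carrier V) T"
  have S: "S w \<in> carrier V" "T (S w) = w" if "w \<in> carrier W" for w
    using that unfolding S_def surj[symmetric] by (simp_all add: inv_into_into f_inv_into_f)
  have S_eq: "S w = v" if "v \<in> carrier V" "T v = w" for v w
    using that inj by (auto simp: S_def)
  have "S \<in> module_hom K W V"
    unfolding module_hom_def by (auto simp: S intro!: S_eq)
  then have linS: "linear_map K W V S"
    by (intro linear_map.intro mod_hom.intro mod_hom_axioms.intro V.vectorspace_axioms
        W.vectorspace_axioms vectorspace.axioms(1)[OF V.vectorspace_axioms]
        vectorspace.axioms(1)[OF W.vectorspace_axioms])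
  have surjS: "S ` carrier W = carrier V"
    using S(1) S_eq T_im by (metis image_eqI image_subsetI subsetI subset_antisym)
  show ?thesis
  proof (cases "V.fin_dim")
    case True
    then show ?thesis using inj surj by (rule dim_eq)
  next
    case False
    \<comment> \<open>otherwise the inverse map would make \<open>V\<close> finite-dimensional\<close>
    have "\<not> W.fin_dim"
      using False linear_map.surj_fin_dim[OF linS _ surjS] by blast
    with False show ?thesis
      unfolding V.dim_def W.dim_def V.fin_dim_def W.fin_dim_def by meson
  qed
qed

context
  fixes R :: "('a, 'b) ring_scheme" and \<mm> :: "'a set" and E :: "('a, 'c) module"
  assumes R: "cring R" and \<mm>: "maximalideal \<mm> R" and E: "module R E"
    and killed: "\<And>r v. \<lbrakk>r \<in> \<mm>; v \<in> carrier E\<rbrakk> \<Longrightarrow> r \<odot>\<^bsub>E\<^esub> v = \<zero>\<^bsub>E\<^esub>"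
begin

interpretation R: cring R by (rule R)
interpretation \<mm>: maximalideal \<mm> R by (rule \<mm>)
interpretation E: module R E by (rule E)

text \<open>Two representatives of a residue class differ by an element of \<open>\<mm>\<close>, which acts as zero; so the
  representative chosen in the definition of the scalar multiplication does not matter.\<close>

lemma residue_smult:
  assumes "r \<in> carrier R" "v \<in> carrier E"
  shows "(\<mm> +>\<^bsub>R\<^esub> r) \<odot>\<^bsub>residue_vectorspace E\<^esub> v = r \<odot>\<^bsub>E\<^esub> v"
proof -
  define s where "s = (SOME s. s \<in> \<mm> +>\<^bsub>R\<^esub> r)"
  have "s \<in> \<mm> +>\<^bsub>R\<^esub> r"
    unfolding s_def using \<mm>.a_rcos_self[OF assms(1)] by (rule someI)
  then obtain a where a: "a \<in> \<mm>" "s = a \<oplus>\<^bsub>R\<^esub> r"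
    by (auto simp: a_r_coset_def')
  then have "s \<odot>\<^bsub>E\<^esub> v = r \<odot>\<^bsub>E\<^esub> v"
    using assms by (simp add: E.smult_l_distr killed \<mm>.Icarr)
  then show ?thesis
    by (simp add: residue_vectorspace_def s_def)
qed

lemma residue_vectorspace_is_vectorspace: "vectorspace (R Quot \<mm>) (residue_vectorspace E)"
proof -
  have field: "field (R Quot \<mm>)"
    by (rule \<mm>.quotient_is_field[OF R])
  have rep: "\<exists>r \<in> carrier R. \<kappa> = \<mm> +>\<^bsub>R\<^esub> r" if "\<kappa> \<in> carrier (R Quot \<mm>)" for \<kappa>
    using that by (auto simp: FactRing_def A_RCOSETS_def')
  have add: "(\<mm> +>\<^bsub>R\<^esub> r) \<oplus>\<^bsub>R Quot \<mm>\<^esub> (\<mm> +>\<^bsub>R\<^esub> s) = \<mm> +>\<^bsub>R\<^esub> (r \<oplus>\<^bsub>R\<^esub> s)"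
    if "r \<in> carrier R" "s \<in> carrier R" for r s
    using that by (simp add: FactRing_def \<mm>.a_rcos_sum)
  have mult: "(\<mm> +>\<^bsub>R\<^esub> r) \<otimes>\<^bsub>R Quot \<mm>\<^esub> (\<mm> +>\<^bsub>R\<^esub> s) = \<mm> +>\<^bsub>R\<^esub> (r \<otimes>\<^bsub>R\<^esub> s)"
    if "r \<in> carrier R" "s \<in> carrier R" for r s
    using that by (simp add: FactRing_def \<mm>.rcoset_mult_add)
  have one: "\<one>\<^bsub>R Quot \<mm>\<^esub> = \<mm> +>\<^bsub>R\<^esub> \<one>\<^bsub>R\<^esub>"
    by (simp add: FactRing_def)
  have V: "carrier (residue_vectorspace E) = carrier E" "add (residue_vectorspace E) = add E"
    "\<zero>\<^bsub>residue_vectorspace E\<^esub> = \<zero>\<^bsub>E\<^esub>"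
    by (simp_all add: residue_vectorspace_def)
  show ?thesis
  proof (rule vs_criteria[OF field], unfold V one)
    show "\<forall>v\<in>carrier E. \<exists>w\<in>carrier E. v \<oplus>\<^bsub>E\<^esub> w = \<zero>\<^bsub>E\<^esub>"
      using E.M.r_neg by blast
    show "\<forall>v w. v \<in> carrier E \<and> w \<in> carrier E \<longrightarrow> v \<oplus>\<^bsub>E\<^esub> w = w \<oplus>\<^bsub>E\<^esub> v"
      using E.M.a_comm by blast
  qed (safe dest!: rep, simp_all add: residue_smult add mult E.M.a_assoc E.smult_l_distr
      E.smult_r_distr E.smult_assoc1)
qed

end

text \<open>Both \<open>E\<close> and \<open>F\<close> are the quotient of \<open>P\<close> by the common kernel, so \<open>f p \<mapsto> g p\<close> is well defined and
  bijective.\<close>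

lemma module_hom_of_common_cover:
  assumes P: "module R P" and E: "module R E" "module R F"
    and f: "f \<in> module_hom R P E" "f ` carrier P = carrier E"
    and g: "g \<in> module_hom R P F" "g ` carrier P = carrier F"
    and ker: "\<And>p. p \<in> carrier P \<Longrightarrow> f p = \<zero>\<^bsub>E\<^esub> \<longleftrightarrow> g p = \<zero>\<^bsub>F\<^esub>"
  obtains \<phi> where "\<phi> \<in> module_hom R E F" "bij_betw \<phi> (carrier E) (carrier F)"
proof -
  interpret P: module R P by fact
  interpret E: module R E by fact
  interpret F: module R F by fact
  define \<phi> where "\<phi> = (\<lambda>v. g (inv_into (carrier P) f v))"
  have cl: "f p \<in> carrier E" "g p \<in> carrier F" if "p \<in> carrier P" for p
    using that f(2) g(2) by auto
  have eq: "f p = f q \<longleftrightarrow> g p = g q" if "p \<in> carrier P" "q \<in> carrier P" for p q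
    using ker[of "p \<ominus>\<^bsub>P\<^esub> q"] that cl
    by (simp add: module_hom_minus[OF P E(1) f(1)] module_hom_minus[OF P E(2) g(1)])
  have \<phi>: "\<phi> (f p) = g p" if "p \<in> carrier P" for p
    unfolding \<phi>_def using that eq by (metis f_inv_into_f imageI inv_into_into)
  have im: "\<exists>p \<in> carrier P. v = f p" if "v \<in> carrier E" for v
    using that f(2) by blast
  show thesis
  proof
    show "\<phi> \<in> module_hom R E F"
      unfolding module_hom_def
      by (auto dest!: im simp: \<phi> cl module_hom_add[OF g(1)] module_hom_smult[OF g(1)]
          module_hom_add[OF f(1), symmetric] module_hom_smult[OF f(1), symmetric])
    show "bij_betw \<phi> (carrier E) (carrier F)"
      unfolding bij_betw_def
    proof
      show "inj_on \<phi> (carrier E)"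
        by (auto dest!: im simp: \<phi> eq inj_on_def)
      show "\<phi> ` carrier E = carrier F"
        unfolding f(2)[symmetric] g(2)[symmetric] image_image by (simp add: \<phi> cong: image_cong)
    qed
  qed
qed

text \<open>The form in which the two Ext modules get compared: it suffices to present both as quotients of
  one module by the same submodule. That \<open>F\<close> too is killed by \<open>\<mm>\<close> then follows from the equality of the
  kernels.\<close>

lemma dim_residue_vectorspace_eq:
  assumes R: "cring R" and \<mm>: "maximalideal \<mm> R"
    and P: "module R P" and E: "module R E" "module R F"
    and f: "f \<in> module_hom R P E" "f ` carrier P = carrier E"
    and g: "g \<in> module_hom R P F" "g ` carrier P = carrier F"
    and ker: "\<And>p. p \<in> carrier P \<Longrightarrow> f p = \<zero>\<^bsub>E\<^esub> \<longleftrightarrow> g p = \<zero>\<^bsub>F\<^esub>"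
    and killed: "\<And>r p. \<lbrakk>r \<in> \<mm>; p \<in> carrier P\<rbrakk> \<Longrightarrow> f (r \<odot>\<^bsub>P\<^esub> p) = \<zero>\<^bsub>E\<^esub>"
  shows "vectorspace.dim (R Quot \<mm>) (residue_vectorspace E)
       = vectorspace.dim (R Quot \<mm>) (residue_vectorspace F)"
proof -
  interpret P: module R P by fact
  interpret \<mm>: maximalideal \<mm> R by fact
  have killE: "r \<odot>\<^bsub>E\<^esub> v = \<zero>\<^bsub>E\<^esub>" if "r \<in> \<mm>" "v \<in> carrier E" for r v
  proof -
    obtain p where p: "p \<in> carrier P" "v = f p" using \<open>v \<in> carrier E\<close> f(2) by blast
    with \<open>r \<in> \<mm>\<close> killed show ?thesis
      by (metis \<mm>.Icarr module_hom_smult[OF f(1)])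
  qed
  have killF: "r \<odot>\<^bsub>F\<^esub> v = \<zero>\<^bsub>F\<^esub>" if "r \<in> \<mm>" "v \<in> carrier F" for r v
  proof -
    obtain p where p: "p \<in> carrier P" "v = g p" using \<open>v \<in> carrier F\<close> g(2) by blast
    with \<open>r \<in> \<mm>\<close> killed ker show ?thesis
      by (metis \<mm>.Icarr module_hom_smult[OF g(1)] P.smult_closed)
  qed
  obtain \<phi> where \<phi>: "\<phi> \<in> module_hom R E F" "bij_betw \<phi> (carrier E) (carrier F)"
    using module_hom_of_common_cover[OF P E f g ker] by blast
  have \<phi>cl: "\<phi> v \<in> carrier F" if "v \<in> carrier E" for v
    using \<phi>(2) that by (auto simp: bij_betw_def)
  interpret V: vectorspace "R Quot \<mm>" "residue_vectorspace E"
    by (rule residue_vectorspace_is_vectorspace[OF R \<mm> E(1) killE])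
  interpret W: vectorspace "R Quot \<mm>" "residue_vectorspace F"
    by (rule residue_vectorspace_is_vectorspace[OF R \<mm> E(2) killF])
  have carr: "carrier (residue_vectorspace E) = carrier E" for E :: "('x, 'y) module"
    by (simp add: residue_vectorspace_def)
  have add: "add (residue_vectorspace E) = add E" for E :: "('x, 'y) module"
    by (simp add: residue_vectorspace_def)
  have rep: "\<exists>r \<in> carrier R. \<kappa> = \<mm> +>\<^bsub>R\<^esub> r" if "\<kappa> \<in> carrier (R Quot \<mm>)" for \<kappa>
    using that by (auto simp: FactRing_def A_RCOSETS_def')
  note smE = residue_smult[OF R \<mm> E(1) killE] and smF = residue_smult[OF R \<mm> E(2) killF]
  have "\<phi> \<in> module_hom (R Quot \<mm>) (residue_vectorspace E) (residue_vectorspace F)"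
    unfolding module_hom_def carr add Pi_iff mem_Collect_eq
    by (safe dest!: rep)
      (simp_all add: \<phi>cl smE smF module_hom_add[OF \<phi>(1)] module_hom_smult[OF \<phi>(1)])
  then have "linear_map (R Quot \<mm>) (residue_vectorspace E) (residue_vectorspace F) \<phi>"
    by (intro linear_map.intro mod_hom.intro mod_hom_axioms.intro V.vectorspace_axioms
        W.vectorspace_axioms vectorspace.axioms(1)[OF V.vectorspace_axioms]
        vectorspace.axioms(1)[OF W.vectorspace_axioms])
  then show ?thesis
    by (rule dim_eq_of_linear_bij) (use \<phi>(2) in \<open>simp add: carr\<close>)
qed

section \<open>Resolutions by finite free modules\<close>

lemma mod_homI:
  "\<lbrakk>module R M; module R N; f \<in> module_hom R M N\<rbrakk> \<Longrightarrow> mod_hom R M N f"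
  by (simp add: mod_hom_def mod_hom_axioms_def)

lemma kernel_is_submodule:
  assumes "module R M" "module R N" "f \<in> module_hom R M N"
  shows "submodule R {v \<in> carrier M. f v = \<zero>\<^bsub>N\<^esub>} M"
  using mod_hom.ker_is_submodule[OF mod_homI[OF assms]] mod_hom.ker_def[OF mod_homI[OF assms]] by simp

lemma ideal_of_submodule:
  assumes R: "cring R" and I: "submodule R I (regular_module R)"
  shows "ideal I R"
proof (rule idealI)
  interpret R: cring R by fact
  show "ring R" ..
  have "r \<otimes>\<^bsub>R\<^esub> a \<in> I" if "a \<in> I" "r \<in> carrier R" for a r
    using submodule.smult_closed[OF I, of r a] that by (simp add: regular_module_def)
  note smult = this
  have sub: "I \<subseteq> carrier R"
    using submodule.subset[OF I] by (simp add: regular_module_def)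
  show "subgroup I (add_monoid R)"
  proof (rule R.add.subgroupI)
    show "I \<noteq> {}"
      using submodule.zero_closed[OF I] by blast
    fix a assume a: "a \<in> I"
    show "\<ominus>\<^bsub>R\<^esub> a \<in> I"
      using smult[OF a, of "\<ominus>\<^bsub>R\<^esub> \<one>\<^bsub>R\<^esub>"] a sub
      by (simp add: R.l_minus subset_iff)
    fix a' assume "a' \<in> I"
    then show "a \<oplus>\<^bsub>R\<^esub> a' \<in> I"
      using submodule.m_closed[OF I a] by (simp add: regular_module_def)
  qed (use sub in simp)
  show "\<And>a r. \<lbrakk>a \<in> I; r \<in> carrier R\<rbrakk> \<Longrightarrow> r \<otimes>\<^bsub>R\<^esub> a \<in> I"
    "\<And>a r. \<lbrakk>a \<in> I; r \<in> carrier R\<rbrakk> \<Longrightarrow> a \<otimes>\<^bsub>R\<^esub> r \<in> I"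
    using smult sub by (simp_all add: R.m_comm subset_iff)
qed

lemma free_module_is_module: "cring R \<Longrightarrow> module R (free_module R n)"
  by (rule cring.func_space_is_module)

lemma free_module_simps:
  assumes "ring R"
  shows "carrier (free_module R n) = {..<n} \<rightarrow>\<^sub>E carrier R"
    and "\<zero>\<^bsub>free_module R n\<^esub> = restrict (\<lambda>_. \<zero>\<^bsub>R\<^esub>) {..<n}"
    and "v \<oplus>\<^bsub>free_module R n\<^esub> w = restrict (\<lambda>i. v i \<oplus>\<^bsub>R\<^esub> w i) {..<n}"
    and "r \<odot>\<^bsub>free_module R n\<^esub> v = restrict (\<lambda>i. r \<otimes>\<^bsub>R\<^esub> v i) {..<n}"
  by (simp_all add: ring.func_space_def[OF assms])

lemma coordinate_hom:
  assumes "ring R" "k < n"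
  shows "(\<lambda>v. v k) \<in> module_hom R (free_module R n) (regular_module R)"
  using assms(2) by (auto simp: module_hom_def free_module_simps[OF assms(1)] regular_module_def)

lemma coordinate_ideal:
  assumes R: "cring R" and H: "submodule R H (free_module R n)" and k: "k < n"
  shows "ideal ((\<lambda>v. v k) ` H) R"
proof -
  interpret R: cring R by fact
  interpret F: module R "free_module R n" using R by (rule free_module_is_module)
  have H': "module R ((free_module R n)\<lparr>carrier := H\<rparr>)"
    using H by (rule F.submodule_is_module)
  have "(\<lambda>v. v k) \<in> module_hom R ((free_module R n)\<lparr>carrier := H\<rparr>) (regular_module R)"
    using coordinate_hom[OF R.ring_axioms k] submodule.subset[OF H]
    by (auto simp: module_hom_def subset_iff Pi_iff)
  then have h: "mod_hom R ((free_module R n)\<lparr>carrier := H\<rparr>) (regular_module R) (\<lambda>v. v k)"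
    by (rule mod_homI[OF H' regular_module_is_module[OF R]])
  show ?thesis
    using ideal_of_submodule[OF R mod_hom.im_is_submodule[OF h]] mod_hom.im_def[OF h] by simp
qed

text \<open>Induction on the number \<open>k\<close> of coordinates that may be nonzero on \<open>K\<close>. The values of the last of
  these coordinates form an ideal, which is finitely generated; lifting its generators to \<open>K\<close> leaves only
  vectors whose last coordinate vanishes, and the induction hypothesis applies to those.\<close>

lemma submodule_of_free_module_finitely_generated_aux:
  assumes R: "cring R" and noeth: "noetherian_ring R"
    and K: "submodule R K (free_module R n)"
    and supp: "\<And>v i. \<lbrakk>v \<in> K; k \<le> i; i < n\<rbrakk> \<Longrightarrow> v i = \<zero>\<^bsub>R\<^esub>"
  shows "\<exists>G. finite G \<and> G \<subseteq> K \<and> K \<subseteq> module.span R (free_module R n) G"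
  using K supp
proof (induction k arbitrary: K)
  case 0
  interpret R: cring R by fact
  interpret F: module R "free_module R n" using R by (rule free_module_is_module)
  have "v = \<zero>\<^bsub>free_module R n\<^esub>" if "v \<in> K" for v
  proof -
    have "v \<in> {..<n} \<rightarrow>\<^sub>E carrier R"
      using that submodule.subset[OF 0(1)] by (auto simp: free_module_simps[OF R.ring_axioms])
    then have "v = restrict v {..<n}"
      by (simp add: PiE_restrict)
    also have "\<dots> = \<zero>\<^bsub>free_module R n\<^esub>"
      unfolding free_module_simps[OF R.ring_axioms] by (rule restrict_ext) (simp add: 0(2)[OF that])
    finally show ?thesis .
  qed
  moreover have "\<zero>\<^bsub>free_module R n\<^esub> \<in> F.span {}"
    by (rule submodule.zero_closed[OF F.span_is_submodule]) simp
  ultimately show ?case by (intro exI[of _ "{}"]) auto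
next
  case (Suc k)
  interpret R: cring R by fact
  interpret F: module R "free_module R n" using R by (rule free_module_is_module)
  show ?case
  proof (cases "k < n")
    case False
    then show ?thesis by (intro Suc.IH Suc.prems) auto
  next
    case True
    note hom = coordinate_hom[OF R.ring_axioms True]
    note mod = F.module_axioms regular_module_is_module[OF R]
    note KF = subsetD[OF submodule.subset[OF Suc.prems(1)]]
    have "\<exists>S \<subseteq> carrier R. finite S \<and> (\<lambda>v. v k) ` K = Idl\<^bsub>R\<^esub> S"
      using noetherian_ring.finetely_gen[OF noeth] coordinate_ideal[OF R Suc.prems(1) True] by blast
    then obtain S where S: "S \<subseteq> carrier R" "finite S" "(\<lambda>v. v k) ` K = Idl\<^bsub>R\<^esub> S" by blast
    have "S \<subseteq> (\<lambda>v. v k) ` K"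
      using R.genideal_self[OF S(1)] S(3) by simp
    then obtain W where W: "W \<subseteq> K" "finite W" "S = (\<lambda>v. v k) ` W"
      using finite_subset_image[OF S(2)] by metis
    have WF: "W \<subseteq> carrier (free_module R n)" using W(1) KF by blast
    define K' where "K' = {v \<in> K. v k = \<zero>\<^bsub>R\<^esub>}"
    have K': "submodule R K' (free_module R n)"
      using Suc.prems(1) KF True unfolding K'_def submodule_def
      by (auto simp: free_module_simps[OF R.ring_axioms])
    have "\<exists>G. finite G \<and> G \<subseteq> K' \<and> K' \<subseteq> F.span G"
    proof (rule Suc.IH[OF K'])
      fix v i assume "v \<in> K'" "k \<le> i" "i < n"
      then show "v i = \<zero>\<^bsub>R\<^esub>"
        using Suc.prems(2)[of v i] by (cases "i = k") (auto simp: K'_def)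
    qed
    then obtain G where G: "finite G" "G \<subseteq> K'" "K' \<subseteq> F.span G" by blast
    have GWF: "G \<union> W \<subseteq> carrier (free_module R n)"
      using G(2) WF KF by (auto simp: K'_def)
    note span = F.span_is_submodule[OF GWF]
    have "K \<subseteq> F.span (G \<union> W)"
    proof
      fix v assume v: "v \<in> K"
      \<comment> \<open>the last coordinate of \<open>v\<close> is also attained on the span of \<open>W\<close>\<close>
      have "Idl\<^bsub>R\<^esub> S \<subseteq> (\<lambda>v. v k) ` F.span W"
        using W(3) F.in_own_span[OF WF]
        by (intro R.genideal_minimal coordinate_ideal[OF R F.span_is_submodule[OF WF] True]) auto
      moreover have "v k \<in> Idl\<^bsub>R\<^esub> S"
        unfolding S(3)[symmetric] using v by (rule imageI)
      ultimately have "v k \<in> (\<lambda>v. v k) ` F.span W" by (rule subsetD)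
      then obtain u where "v k = u k" and u: "u \<in> F.span W" by (rule imageE)
      have uK: "u \<in> K"
        using F.span_is_subset[OF W(1) Suc.prems(1)] u by blast
      have "v \<ominus>\<^bsub>free_module R n\<^esub> u \<in> K'"
      proof -
        have "(v \<ominus>\<^bsub>free_module R n\<^esub> u) k = v k \<ominus>\<^bsub>regular_module R\<^esub> u k"
          using module_hom_minus[OF mod hom] v uK KF by simp
        also have "\<dots> = \<zero>\<^bsub>regular_module R\<^esub>"
          unfolding \<open>v k = u k\<close>
          using module_hom_closed[OF hom] uK KF module.axioms(2)[OF mod(2)]
          by (intro abelian_group.minus_other_side[THEN iffD2]) auto
        finally have "(v \<ominus>\<^bsub>free_module R n\<^esub> u) k = \<zero>\<^bsub>R\<^esub>" by (simp add: regular_module_def)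
        moreover have "v \<ominus>\<^bsub>free_module R n\<^esub> u \<in> K"
          unfolding a_minus_def
          using abelian_subgroup_of_submodule[OF Suc.prems(1)] uK
          by (intro submodule.m_closed[OF Suc.prems(1) v] additive_subgroup.a_inv_closed
              abelian_subgroup.axioms(1))
        ultimately show ?thesis by (simp add: K'_def)
      qed
      then have "v \<ominus>\<^bsub>free_module R n\<^esub> u \<in> F.span (G \<union> W)"
        using G(3) F.span_is_monotone[of G "G \<union> W"] by blast
      moreover have "u \<in> F.span (G \<union> W)"
        using u F.span_is_monotone[of W "G \<union> W"] by blast
      ultimately have "(v \<ominus>\<^bsub>free_module R n\<^esub> u) \<oplus>\<^bsub>free_module R n\<^esub> u \<in> F.span (G \<union> W)"
        by (rule submodule.m_closed[OF span])
      then show "v \<in> F.span (G \<union> W)"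
        using KF[OF v] KF[OF uK] by (simp add: a_minus_def F.M.a_assoc F.M.l_neg)
    qed
    then show ?thesis
      using G W by (intro exI[of _ "G \<union> W"]) (auto simp: K'_def)
  qed
qed

lemma submodule_of_free_module_finitely_generated:
  assumes R: "cring R" and noeth: "noetherian_ring R" and K: "submodule R K (free_module R n)"
  obtains G where "finite G" "G \<subseteq> K" "module.span R (free_module R n) G = K"
proof -
  interpret F: module R "free_module R n" using R by (rule free_module_is_module)
  obtain G where G: "finite G" "G \<subseteq> K" "K \<subseteq> F.span G"
    using submodule_of_free_module_finitely_generated_aux[OF assms, of n] by auto
  then show thesis
    using F.span_is_subset[OF G(2) K] that by blast
qed

lemma free_cover:
  assumes M: "module R M" and A: "finite A" "A \<subseteq> carrier M"
  obtains n d where "d \<in> module_hom R (free_module R n) M"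
    "d ` carrier (free_module R n) = module.span R M A"
proof -
  interpret M: module R M by fact
  note F = free_module_simps[OF M.R.ring_axioms]
  define n where "n = card A"
  obtain h where h: "bij_betw h {..<n} A"
    unfolding n_def atLeast0LessThan[symmetric] using ex_bij_betw_nat_finite[OF A(1)] by blast
  define h' where "h' = inv_into {..<n} h"
  have h': "h' a < n" "h (h' a) = a" if "a \<in> A" for a
    using that h unfolding h'_def bij_betw_def by (metis inv_into_into lessThan_iff, metis f_inv_into_f)
  have h'h: "h' (h i) = i" "h i \<in> A" if "i < n" for i
    using that h unfolding h'_def bij_betw_def by auto
  define d where "d = (\<lambda>c. M.lincomb (restrict (\<lambda>a. c (h' a)) A) A)"
  interpret L: mod_hom R "M.func_space A" M "\<lambda>a. M.lincomb a A"
    using A by (rule M.lincomb_is_mod_hom)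
  have "d \<in> module_hom R (free_module R n) M"
  proof -
    have cl: "restrict (\<lambda>a. c (h' a)) A \<in> carrier (M.func_space A)"
      if "c \<in> carrier (free_module R n)" for c
      using that h' by (auto simp: F M.func_space_def)
    have add: "restrict (\<lambda>a. (c \<oplus>\<^bsub>free_module R n\<^esub> c') (h' a)) A
        = restrict (\<lambda>a. c (h' a)) A \<oplus>\<^bsub>M.func_space A\<^esub> restrict (\<lambda>a. c' (h' a)) A" for c c'
      using h' by (auto simp: F M.func_space_def fun_eq_iff)
    have smult: "restrict (\<lambda>a. (r \<odot>\<^bsub>free_module R n\<^esub> c) (h' a)) A
        = r \<odot>\<^bsub>M.func_space A\<^esub> restrict (\<lambda>a. c (h' a)) A" for c r
      using h' by (auto simp: F M.func_space_def fun_eq_iff)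
    show ?thesis
      unfolding module_hom_def d_def mem_Collect_eq
    proof (intro conjI allI impI funcsetI, goal_cases)
      case (1 c)
      then show ?case using cl by (intro L.f_im)
    next
      case (2 c c')
      then show ?case unfolding add using cl by (intro L.f_add) auto
    next
      case (3 r c)
      then show ?case unfolding smult using cl by (intro L.f_smult) auto
    qed
  qed
  moreover have "d ` carrier (free_module R n) = M.span A"
  proof
    show "d ` carrier (free_module R n) \<subseteq> M.span A"
    proof (rule image_subsetI)
      fix c assume "c \<in> carrier (free_module R n)"
      then have "restrict (\<lambda>a. c (h' a)) A \<in> A \<rightarrow> carrier R"
        using h' by (auto simp: F)
      then show "d c \<in> M.span A"
        unfolding M.finite_span[OF A] d_def by blast
    qed
    show "M.span A \<subseteq> d ` carrier (free_module R n)"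
    proof
      fix v assume "v \<in> M.span A"
      then obtain a where a: "a \<in> A \<rightarrow> carrier R" "v = M.lincomb a A"
        unfolding M.finite_span[OF A] by blast
      have "v = d (restrict (\<lambda>i. a (h i)) {..<n})"
        unfolding d_def a(2) using a(1) h' A by (intro M.lincomb_cong) auto
      moreover have "restrict (\<lambda>i. a (h i)) {..<n} \<in> carrier (free_module R n)"
        using a(1) h'h by (auto simp: F)
      ultimately show "v \<in> d ` carrier (free_module R n)" by blast
    qed
  qed
  ultimately show thesis by (rule that)
qed

text \<open>Cover \<open>N\<close> by a finite free module, then the kernel of this map, then the kernel of the next one,
  and so on. Every kernel is a submodule of a finite free module and therefore finitely generated. The
  successive choices depend on each other, which calls for dependent choice on pairs of a rank and a
  kernel.\<close>

lemma exists_free_resolution: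
  assumes R: "cring R" and noeth: "noetherian_ring R"
    and N: "module R N" and A: "finite A" "A \<subseteq> carrier N" "module.span R N A = carrier N"
  shows "\<exists>b d e. free_resolution R N b d e"
proof -
  obtain b0 e where e: "e \<in> module_hom R (free_module R b0) N"
    "e ` carrier (free_module R b0) = carrier N"
    using free_cover[OF N A(1,2)] A(3) by metis
  define ker where "ker = (\<lambda>n d m. {v \<in> carrier (free_module R n). d v = \<zero>\<^bsub>free_module R m\<^esub>})"
  define K0 where "K0 = {v \<in> carrier (free_module R b0). e v = \<zero>\<^bsub>N\<^esub>}"
  \<comment> \<open>the clause for \<open>i = 0\<close> makes the chosen sequence start with the kernel of \<open>e\<close>\<close>
  define P where "P = (\<lambda>(i :: nat) (n, K). submodule R K (free_module R n) \<and> (i = 0 \<longrightarrow> (n, K) = (b0, K0)))"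
  define Q where "Q = (\<lambda>(n, K) (n', K') d. d \<in> module_hom R (free_module R n') (free_module R n)
    \<and> d ` carrier (free_module R n') = K \<and> K' = ker n' d n)"
  have "\<exists>f. \<forall>i. P i (f i) \<and> (\<exists>d. Q (f i) (f (Suc i)) d)"
  proof (rule dependent_nat_choice)
    show "\<exists>x. P 0 x"
      unfolding P_def K0_def
      using kernel_is_submodule[OF free_module_is_module[OF R] N e(1)] by auto
    fix x i assume Pi: "P i x"
    obtain n K where x: "x = (n, K)" by fastforce
    with Pi have K: "submodule R K (free_module R n)" by (simp add: P_def)
    obtain G where G: "finite G" "G \<subseteq> K" "module.span R (free_module R n) G = K"
      using submodule_of_free_module_finitely_generated[OF R noeth K] by blast
    have "G \<subseteq> carrier (free_module R n)"
      using G(2) submodule.subset[OF K] by (rule subset_trans)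
    then obtain n' d where d: "d \<in> module_hom R (free_module R n') (free_module R n)"
      "d ` carrier (free_module R n') = K"
      using free_cover[OF free_module_is_module[OF R] G(1)] G(3) by metis
    have "P (Suc i) (n', ker n' d n)"
      unfolding P_def ker_def
      using kernel_is_submodule[OF free_module_is_module[OF R] free_module_is_module[OF R] d(1)] by simp
    moreover have "Q x (n', ker n' d n) d"
      using d by (simp add: Q_def x)
    ultimately show "\<exists>y. P (Suc i) y \<and> (\<exists>d. Q x y d)" by blast
  qed
  then obtain f where f: "\<And>i. P i (f i)" "\<And>i. \<exists>d. Q (f i) (f (Suc i)) d" by blast
  then obtain d where d: "\<And>i. Q (f i) (f (Suc i)) (d i)" by metis
  define b where "b = (\<lambda>i. fst (f i))"
  have f0: "f 0 = (b0, K0)"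
    using f(1)[of 0] by (auto simp: P_def)
  have hom: "d i \<in> module_hom R (free_module R (b (Suc i))) (free_module R (b i))"
    and im: "d i ` carrier (free_module R (b (Suc i))) = snd (f i)"
    and ker: "snd (f (Suc i)) = ker (b (Suc i)) (d i) (b i)" for i
    using d[of i] by (auto simp: Q_def b_def case_prod_beta)
  have "free_resolution R N b d e"
    unfolding free_resolution_def
  proof (intro conjI allI)
    show "e \<in> module_hom R (free_module R (b 0)) N" "e ` carrier (free_module R (b 0)) = carrier N"
      using e by (simp_all add: b_def f0)
    show "d 0 ` carrier (free_module R (b 1)) = {v \<in> carrier (free_module R (b 0)). e v = \<zero>\<^bsub>N\<^esub>}"
      using im[of 0] by (simp add: f0 K0_def b_def)
    show "d (Suc i) ` carrier (free_module R (b (Suc (Suc i)))) =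
        {v \<in> carrier (free_module R (b (Suc i))). d i v = \<zero>\<^bsub>free_module R (b i)\<^esub>}" for i
      using im[of "Suc i"] ker[of i] by (simp add: ker_def)
  qed (rule hom)
  then show ?thesis by blast
qed

section \<open>Krull dimensions of quotient rings\<close>

text \<open>Taking preimages of primes preserves strict inclusions when the map is onto.\<close>

lemma krull_dim_le_of_surjective_hom:
  assumes R: "cring R" and S: "cring S" and h: "h \<in> ring_hom R S" "h ` carrier R = carrier S"
  shows "krull_dim S \<le> krull_dim R"
proof -
  interpret h: ring_hom_ring R S h
    using R S h(1) by (intro ring_hom_ringI2) (auto simp: cring_def)
  define V where "V = (\<lambda>P. {r \<in> carrier R. h r \<in> P})"
  have mono: "V P \<subset> V Q" if PQ: "P \<subset> Q" and Q: "primeideal Q S" for P Q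
  proof -
    have "Q \<subseteq> carrier S"
      using Q by (auto dest!: primeideal.axioms(1) ideal.axioms(1) additive_subgroup.a_subset)
    obtain s where s: "s \<in> Q" "s \<notin> P" using PQ by blast
    then have "s \<in> h ` carrier R" using h(2) \<open>Q \<subseteq> carrier S\<close> by (simp only: subsetD)
    then obtain r where r: "s = h r" "r \<in> carrier R" by (rule imageE)
    show ?thesis
    proof (rule psubsetI)
      show "V P \<subseteq> V Q"
        unfolding V_def using PQ by blast
      have "r \<in> V Q" "r \<notin> V P"
        unfolding V_def using r s by simp_all
      then show "V P \<noteq> V Q" by blast
    qed
  qed
  have "\<exists>P. (\<forall>i\<le>n. primeideal (P i) R) \<and> (\<forall>i<n. P i \<subset> P (Suc i))"
    if P: "\<forall>i\<le>n. primeideal (P i) S" "\<forall>i<n. P i \<subset> P (Suc i)" for n P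
    using P h.primeideal_vimage[OF R] mono
    by (intro exI[of _ "\<lambda>i. V (P i)"]) (simp add: V_def)
  then show ?thesis
    unfolding krull_dim_def by (intro Sup_subset_mono) blast
qed

lemma krull_dim_quotient_by_zero:
  assumes R: "cring R"
  shows "krull_dim (R Quot {\<zero>\<^bsub>R\<^esub>}) = krull_dim R"
proof -
  interpret R: cring R by fact
  interpret Z: ideal "{\<zero>\<^bsub>R\<^esub>}" R by (rule R.zeroideal)
  have Q: "cring (R Quot {\<zero>\<^bsub>R\<^esub>})" by (rule Z.quotient_is_cring[OF R])
  have "bij_betw ((+>\<^bsub>R\<^esub>) {\<zero>\<^bsub>R\<^esub>}) (carrier R) (carrier (R Quot {\<zero>\<^bsub>R\<^esub>}))"
    unfolding bij_betw_def FactRing_def A_RCOSETS_def' a_r_coset_def'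
    by (auto simp: inj_on_def)
  then have iso: "(+>\<^bsub>R\<^esub>) {\<zero>\<^bsub>R\<^esub>} \<in> ring_iso R (R Quot {\<zero>\<^bsub>R\<^esub>})"
    by (simp add: ring_iso_def Z.rcos_ring_hom)
  note inv = ring_iso_set_sym[OF R.ring_axioms iso]
  show ?thesis
    using krull_dim_le_of_surjective_hom[OF R Q, of "(+>\<^bsub>R\<^esub>) {\<zero>\<^bsub>R\<^esub>}"]
      krull_dim_le_of_surjective_hom[OF Q R, of "inv_into (carrier R) ((+>\<^bsub>R\<^esub>) {\<zero>\<^bsub>R\<^esub>})"] iso inv
    by (auto simp: ring_iso_def bij_betw_def)
qed

lemma primeideal_pow_mem:
  assumes "primeideal P R" "r \<in> carrier R" "r [^]\<^bsub>R\<^esub> (n :: nat) \<in> P"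
  shows "r \<in> P"
proof -
  interpret primeideal P R by fact
  show ?thesis
    using assms(3)
  proof (induction n)
    case 0
    then show ?case using one_imp_carrier I_notcarr by simp
  next
    case (Suc n)
    then show ?case using I_prime[of "r [^]\<^bsub>R\<^esub> n" r] assms(2) by auto
  qed
qed

text \<open>The preimage in \<open>R\<close> of a prime of \<open>R/I\<close> contains \<open>I\<close>, hence its radical \<open>\<mm>\<close>, hence equals \<open>\<mm>\<close>. So
  there is at most one prime, and no proper chain.\<close>

lemma krull_dim_quotient_by_primary_of_maximal:
  assumes R: "cring R" and \<mm>: "maximalideal \<mm> R" and I: "primary_to R \<mm> I"
  shows "krull_dim (R Quot I) = 0"
proof -
  interpret R: cring R by fact
  interpret I: ideal I R using I by (simp add: primary_to_def primary_ideal_def)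
  interpret \<mm>: maximalideal \<mm> R by fact
  have zero: "\<zero>\<^bsub>R Quot I\<^esub> = I"
    by (simp add: FactRing_def)
  define V where "V = (\<lambda>P. {r \<in> carrier R. I +>\<^bsub>R\<^esub> r \<in> P})"
  have V: "V P = \<mm>" if P: "primeideal P (R Quot I)" for P
  proof -
    have prime: "primeideal (V P) R"
      unfolding V_def by (rule ring_hom_ring.primeideal_vimage[OF I.rcos_ring_hom_ring R P])
    note ideal = primeideal.axioms(1)[OF prime]
    have "I \<in> P"
      using additive_subgroup.zero_closed[OF ideal.axioms(1)[OF primeideal.axioms(1)[OF P]]]
      unfolding zero .
    then have "I \<subseteq> V P"
      unfolding V_def by (auto simp only: I.a_rcos_const I.Icarr mem_Collect_eq subset_iff)
    then have "\<mm> \<subseteq> V P"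
      using I primeideal_pow_mem[OF prime] unfolding primary_to_def radical_def by blast
    then show ?thesis
      using \<mm>.I_maximal[OF ideal _ additive_subgroup.a_subset[OF ideal.axioms(1)[OF ideal]]]
        primeideal.I_notcarr[OF prime] by metis
  qed
  have surj: "\<exists>r \<in> carrier R. s = I +>\<^bsub>R\<^esub> r" if "s \<in> carrier (R Quot I)" for s
    using that by (auto simp: FactRing_def A_RCOSETS_def')
  have "n = 0" if P: "\<forall>i\<le>n. primeideal (P i) (R Quot I)" "\<forall>i<n. P i \<subset> P (Suc i)"
    for n and P :: "nat \<Rightarrow> 'a set set"
  proof (rule ccontr)
    assume "n \<noteq> 0"
    then have prime: "primeideal (P 0) (R Quot I)" "primeideal (P 1) (R Quot I)" and "P 0 \<subset> P 1"
      using P(1)[rule_format, of 0] P(1)[rule_format, of 1] P(2)[rule_format, of 0] by auto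
    then obtain s where s: "s \<in> P 1" "s \<notin> P 0" by blast
    have "s \<in> carrier (R Quot I)"
      by (rule ideal.Icarr[OF primeideal.axioms(1)[OF prime(2)] s(1)])
    then obtain r where "r \<in> carrier R" "s = I +>\<^bsub>R\<^esub> r" using surj by blast
    then have "r \<in> V (P 1)" "r \<notin> V (P 0)" using s by (auto simp: V_def)
    then show False using V prime by simp
  qed
  then have "krull_dim (R Quot I) \<le> 0"
    unfolding krull_dim_def by (intro Sup_least) (force simp: zero_enat_def)
  then show ?thesis by simp
qed

section \<open>Nonzerodivisors, annihilators and colon ideals\<close>

lemma nonzerodivisor_cancel:
  assumes "cring R" "nonzerodivisor R x" "a \<in> carrier R" "b \<in> carrier R"
    "x \<otimes>\<^bsub>R\<^esub> a = x \<otimes>\<^bsub>R\<^esub> b"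
  shows "a = b"
proof -
  interpret cring R by fact
  have "x \<otimes>\<^bsub>R\<^esub> (a \<ominus>\<^bsub>R\<^esub> b) = \<zero>\<^bsub>R\<^esub>"
    using assms(2-5) by (simp add: nonzerodivisor_def a_minus_def r_distr r_minus r_neg)
  then have "a \<ominus>\<^bsub>R\<^esub> b = \<zero>\<^bsub>R\<^esub>"
    using assms(2-4) by (simp add: nonzerodivisor_def)
  then show ?thesis using assms(3,4) by simp
qed

lemma nonzerodivisor_pow:
  assumes "cring R" "nonzerodivisor R x" "y \<in> carrier R" "x [^]\<^bsub>R\<^esub> (n :: nat) \<otimes>\<^bsub>R\<^esub> y = \<zero>\<^bsub>R\<^esub>"
  shows "y = \<zero>\<^bsub>R\<^esub>"
proof -
  interpret cring R by fact
  have x: "x \<in> carrier R" using assms(2) by (simp add: nonzerodivisor_def)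
  show ?thesis
    using assms(3,4)
  proof (induction n arbitrary: y)
    case 0
    then show ?case by simp
  next
    case (Suc n)
    have "x [^]\<^bsub>R\<^esub> n \<otimes>\<^bsub>R\<^esub> (x \<otimes>\<^bsub>R\<^esub> y) = \<zero>\<^bsub>R\<^esub>"
      using Suc.prems x m_assoc[OF nat_pow_closed[OF x, of n] x Suc.prems(1)] by simp
    then have "x \<otimes>\<^bsub>R\<^esub> y = \<zero>\<^bsub>R\<^esub>"
      by (rule Suc.IH[OF m_closed[OF x Suc.prems(1)]])
    then show ?case
      using assms(2) Suc.prems(1) by (simp add: nonzerodivisor_def)
  qed
qed

text \<open>\<open>I\<close> contains a nonzerodivisor, so nothing but zero kills it.\<close>

lemma annihilator_ideal_module:
  assumes R: "cring R" and I: "ideal I R" and x: "nonzerodivisor R x" "x [^]\<^bsub>R\<^esub> (n :: nat) \<in> I"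
  shows "annihilator R (ideal_module R I) = {\<zero>\<^bsub>R\<^esub>}"
proof -
  interpret R: cring R by fact
  interpret I: ideal I R by fact
  have "r = \<zero>\<^bsub>R\<^esub>" if "r \<in> carrier R" "\<forall>v \<in> I. r \<otimes>\<^bsub>R\<^esub> v = \<zero>\<^bsub>R\<^esub>" for r
  proof (rule nonzerodivisor_pow[OF R x(1) that(1)])
    show "x [^]\<^bsub>R\<^esub> n \<otimes>\<^bsub>R\<^esub> r = \<zero>\<^bsub>R\<^esub>"
      using bspec[OF that(2) x(2)] R.m_comm[OF that(1) I.Icarr[OF x(2)]] by simp
  qed
  then show ?thesis
    by (auto simp: annihilator_def ideal_module_def regular_module_def I.Icarr)
qed

lemma annihilator_quotient_module:
  assumes R: "cring R" and I: "ideal I R"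
  shows "annihilator R (quotient_module (regular_module R) I) = I"
proof -
  interpret R: cring R by fact
  interpret I: ideal I R by fact
  note sub = ideal_is_submodule[OF R I]
  have "(\<forall>v \<in> carrier (quotient_module (regular_module R) I).
      r \<odot>\<^bsub>quotient_module (regular_module R) I\<^esub> v = \<zero>\<^bsub>quotient_module (regular_module R) I\<^esub>)
      \<longleftrightarrow> (\<forall>s \<in> carrier R. r \<otimes>\<^bsub>R\<^esub> s \<in> I)" if "r \<in> carrier R" for r
  proof -
    have "r \<odot>\<^bsub>quotient_module (regular_module R) I\<^esub> (I +>\<^bsub>regular_module R\<^esub> s)
        = I +>\<^bsub>regular_module R\<^esub> (r \<otimes>\<^bsub>R\<^esub> s)" if "s \<in> carrier R" for s
      using module_hom_smult[OF coset_map_hom[OF sub] \<open>r \<in> carrier R\<close>, of s] that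
      by (simp add: regular_module_def)
    then show ?thesis
      using that coset_eq_zero_iff[OF sub]
      by (simp add: carrier_quotient_module[OF sub]) (simp add: regular_module_def)
  qed
  moreover have "(\<forall>s \<in> carrier R. r \<otimes>\<^bsub>R\<^esub> s \<in> I) \<longleftrightarrow> r \<in> I" if "r \<in> carrier R" for r
    using that I.I_r_closed R.r_one[OF that] R.one_closed by metis
  ultimately have "r \<in> annihilator R (quotient_module (regular_module R) I) \<longleftrightarrow> r \<in> I"
    if "r \<in> carrier R" for r
    unfolding annihilator_def using that by simp
  moreover have "annihilator R (quotient_module (regular_module R) I) \<subseteq> carrier R"
    unfolding annihilator_def by (rule Collect_restrict)
  ultimately show ?thesis
    using I.a_subset by blast
qed

text \<open>The heart of the matter. For a product \<open>s = ja\<close> with \<open>j \<in> J\<close> and \<open>a \<in> \<mm>\<close> one has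
  \<open>sy = j(ay) \<in> j\<cdot>xI \<subseteq> x\<cdot>IJ \<subseteq> x\<^sup>2R\<close>, and therefore \<open>sy \<in> x\<^sup>2R\<close> for all \<open>s \<in> J\<mm>\<close>. Take \<open>s = x\<close> and cancel \<open>x\<close>.\<close>

lemma mem_multiples_of_colon_multiples:
  assumes R: "cring R" and I: "ideal I R" and J: "ideal J R" and \<mm>: "ideal \<mm> R"
    and x: "nonzerodivisor R x" "x \<in> J \<cdot>\<^bsub>R\<^esub> \<mm>" and IJ: "I \<cdot>\<^bsub>R\<^esub> J \<subseteq> PIdl\<^bsub>R\<^esub> x"
    and y: "y \<in> I" and ym: "\<And>a. a \<in> \<mm> \<Longrightarrow> \<exists>i \<in> I. a \<otimes>\<^bsub>R\<^esub> y = x \<otimes>\<^bsub>R\<^esub> i"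
  shows "\<exists>z \<in> carrier R. y = x \<otimes>\<^bsub>R\<^esub> z"
proof -
  interpret R: cring R by fact
  interpret I: ideal I R by fact
  interpret J: ideal J R by fact
  interpret \<mm>: ideal \<mm> R by fact
  have xR: "x \<in> carrier R" using x(1) by (simp add: nonzerodivisor_def)
  have yR: "y \<in> carrier R" using y by (rule I.Icarr)
  have sR: "s \<in> carrier R" if "s \<in> J \<cdot>\<^bsub>R\<^esub> \<mm>" for s
    using that R.ideal_prod_in_carrier[OF J \<mm>] by blast
  have "\<exists>z \<in> carrier R. s \<otimes>\<^bsub>R\<^esub> y = x \<otimes>\<^bsub>R\<^esub> (x \<otimes>\<^bsub>R\<^esub> z)" if "s \<in> J \<cdot>\<^bsub>R\<^esub> \<mm>" for s
    using that
  proof (induction s rule: ideal_prod.induct)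
    case (prod j a)
    then obtain i where i: "i \<in> I" "a \<otimes>\<^bsub>R\<^esub> y = x \<otimes>\<^bsub>R\<^esub> i" using ym by blast
    have "i \<otimes>\<^bsub>R\<^esub> j \<in> PIdl\<^bsub>R\<^esub> x" using IJ i(1) prod(1) by (auto intro: ideal_prod.prod)
    then obtain z where z: "z \<in> carrier R" "i \<otimes>\<^bsub>R\<^esub> j = z \<otimes>\<^bsub>R\<^esub> x"
      by (auto simp: cgenideal_def)
    have jR: "j \<in> carrier R" and aR: "a \<in> carrier R" and iR: "i \<in> carrier R"
      using prod i(1) J.Icarr \<mm>.Icarr I.Icarr by auto
    have "(j \<otimes>\<^bsub>R\<^esub> a) \<otimes>\<^bsub>R\<^esub> y = j \<otimes>\<^bsub>R\<^esub> (x \<otimes>\<^bsub>R\<^esub> i)"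
      using jR aR yR i(2) by (simp add: R.m_assoc)
    also have "\<dots> = x \<otimes>\<^bsub>R\<^esub> (i \<otimes>\<^bsub>R\<^esub> j)"
      using jR iR xR by (simp add: R.m_ac)
    also have "\<dots> = x \<otimes>\<^bsub>R\<^esub> (x \<otimes>\<^bsub>R\<^esub> z)"
      using z xR by (simp add: R.m_comm)
    finally show ?case using z(1) by blast
  next
    case (sum s t)
    then obtain z w where "z \<in> carrier R" "s \<otimes>\<^bsub>R\<^esub> y = x \<otimes>\<^bsub>R\<^esub> (x \<otimes>\<^bsub>R\<^esub> z)"
      "w \<in> carrier R" "t \<otimes>\<^bsub>R\<^esub> y = x \<otimes>\<^bsub>R\<^esub> (x \<otimes>\<^bsub>R\<^esub> w)" by blast
    then have "(s \<oplus>\<^bsub>R\<^esub> t) \<otimes>\<^bsub>R\<^esub> y = x \<otimes>\<^bsub>R\<^esub> (x \<otimes>\<^bsub>R\<^esub> (z \<oplus>\<^bsub>R\<^esub> w))"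
      using sum.hyps yR xR sR by (simp add: R.l_distr R.r_distr)
    with \<open>z \<in> carrier R\<close> \<open>w \<in> carrier R\<close> show ?case by blast
  qed
  from this[OF x(2)] obtain z where "z \<in> carrier R" "x \<otimes>\<^bsub>R\<^esub> y = x \<otimes>\<^bsub>R\<^esub> (x \<otimes>\<^bsub>R\<^esub> z)" by blast
  then show ?thesis
    using nonzerodivisor_cancel[OF R x(1) yR, of "x \<otimes>\<^bsub>R\<^esub> z"] xR by blast
qed

section \<open>Submodules and the Hom functors\<close>

lemma module_hom_comp:
  "\<lbrakk>f \<in> module_hom R L M; g \<in> module_hom R M N\<rbrakk> \<Longrightarrow> (\<lambda>v. g (f v)) \<in> module_hom R L N"
  by (simp add: module_hom_def Pi_iff)

lemma module_hom_restrict: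
  assumes "f \<in> module_hom R M N" "P \<subseteq> carrier M" "\<And>p. p \<in> P \<Longrightarrow> f p \<in> Q"
  shows "f \<in> module_hom R (M\<lparr>carrier := P\<rparr>) (N\<lparr>carrier := Q\<rparr>)"
  using assms by (simp add: module_hom_def subset_iff Pi_iff)

lemma submodule_of_submodule:
  assumes "submodule R H M" "submodule R Z M" "H \<subseteq> Z"
  shows "submodule R H (M\<lparr>carrier := Z\<rparr>)"
  by (rule submodule.intro[OF module.submodule_is_module[OF submodule.module[OF assms(2)] assms(2)]])
    (simp_all add: assms(3) submodule.m_closed[OF assms(1)] submodule.zero_closed[OF assms(1)]
      submodule.smult_closed[OF assms(1)])

lemma zero_submodule:
  assumes "module R M"
  shows "submodule R {\<zero>\<^bsub>M\<^esub>} M"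
proof -
  interpret module R M by fact
  show ?thesis by (rule submodule.intro[OF assms]) auto
qed

lemma image_is_submodule:
  assumes "module R M" "module R N" "f \<in> module_hom R M N"
  shows "submodule R (f ` carrier M) N"
  using mod_hom.im_is_submodule[OF mod_homI[OF assms]] mod_hom.im_def[OF mod_homI[OF assms]] by simp

lemma Hom_module_simps:
  "carrier (Hom_module R M N) = module_hom R M N \<inter> extensional (carrier M)"
  "\<zero>\<^bsub>Hom_module R M N\<^esub> = restrict (\<lambda>_. \<zero>\<^bsub>N\<^esub>) (carrier M)"
  "f \<oplus>\<^bsub>Hom_module R M N\<^esub> g = restrict (\<lambda>v. f v \<oplus>\<^bsub>N\<^esub> g v) (carrier M)"
  "r \<odot>\<^bsub>Hom_module R M N\<^esub> f = restrict (\<lambda>v. r \<odot>\<^bsub>N\<^esub> f v) (carrier M)"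
  by (simp_all add: Hom_module_def)

text \<open>Identifies cochains with values in \<open>I\<close> with those linear maps to \<open>R\<close> whose values lie in \<open>I\<close>, so
  that both kinds can be handled together.\<close>

lemma Hom_ideal_module:
  assumes "ideal I R"
  shows "Hom_module R F (ideal_module R I) = (Hom_module R F (regular_module R))
    \<lparr>carrier := {f \<in> carrier (Hom_module R F (regular_module R)). \<forall>v \<in> carrier F. f v \<in> I}\<rparr>"
proof -
  have "module_hom R F (ideal_module R I) = {f \<in> module_hom R F (regular_module R). \<forall>v \<in> carrier F. f v \<in> I}"
    using ideal.Icarr[OF assms]
    by (simp add: module_hom_def ideal_module_def regular_module_def Pi_iff) blast
  then have "module_hom R F (ideal_module R I) \<inter> extensional (carrier F)
      = {f \<in> module_hom R F (regular_module R) \<inter> extensional (carrier F). \<forall>v \<in> carrier F. f v \<in> I}"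
    by blast
  then show ?thesis
    by (simp add: Hom_module_def ideal_module_def regular_module_def)
qed

lemma precompose_hom:
  assumes F: "module R F'" and d: "d \<in> module_hom R F' F"
  shows "(\<lambda>f. compose (carrier F') f d) \<in> module_hom R (Hom_module R F N) (Hom_module R F' N)"
proof -
  interpret F: module R F' by fact
  have cl: "d v \<in> carrier F" if "v \<in> carrier F'" for v
    using module_hom_closed[OF d] that by blast
  show ?thesis
    unfolding module_hom_def Hom_module_simps mem_Collect_eq
  proof (intro conjI allI impI funcsetI IntI, goal_cases)
    case (1 f)
    then show ?case
      by (auto simp: cl module_hom_def compose_def module_hom_add[OF d] module_hom_smult[OF d])
  qed (auto simp: compose_def fun_eq_iff cl)
qed

lemma postcompose_hom:
  assumes F: "module R F" and h: "h \<in> module_hom R N L"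
  shows "(\<lambda>f. compose (carrier F) h f) \<in> module_hom R (Hom_module R F N) (Hom_module R F L)"
proof -
  interpret F: module R F by fact
  have cl: "f v \<in> carrier N" if "f \<in> module_hom R F N" "v \<in> carrier F" for f v
    using module_hom_closed[OF that(1)] that(2) by blast
  have clh: "h v \<in> carrier L" if "v \<in> carrier N" for v
    using module_hom_closed[OF h] that by blast
  show ?thesis
    unfolding module_hom_def[of R "Hom_module R F N"] Hom_module_simps mem_Collect_eq
  proof (intro conjI allI impI funcsetI IntI, goal_cases)
    case (1 f)
    then have f: "f \<in> module_hom R F N" by simp
    show ?case
      unfolding module_hom_def
      by (auto simp: cl[OF f] clh compose_def module_hom_add[OF h] module_hom_smult[OF h]
          module_hom_add[OF f] module_hom_smult[OF f])
  next
    case (3 f g)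
    then have "f \<in> module_hom R F N" "g \<in> module_hom R F N" by auto
    note cl = this[THEN cl]
    show ?case by (auto simp: compose_def fun_eq_iff cl module_hom_add[OF h])
  next
    case (4 r f)
    then have "r \<in> carrier R" "f \<in> module_hom R F N" by auto
    note cl = this(1) this(2)[THEN cl]
    show ?case by (auto simp: compose_def fun_eq_iff cl module_hom_smult[OF h])
  qed (auto simp: compose_def)
qed

section \<open>Projectivity of finite free modules\<close>

definition std_basis :: "('a, 'b) ring_scheme \<Rightarrow> nat \<Rightarrow> nat \<Rightarrow> nat \<Rightarrow> 'a" where
  "std_basis R n i = restrict (\<lambda>j. if i = j then \<one>\<^bsub>R\<^esub> else \<zero>\<^bsub>R\<^esub>) {..<n}"

text \<open>Induction on the number \<open>k\<close> of coordinates that may be nonzero, splitting off one multiple of a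
  basis vector at a time.\<close>

lemma free_module_hom_eqI:
  assumes R: "cring R" and N: "module R N"
    and f: "f \<in> module_hom R (free_module R n) N" and g: "g \<in> module_hom R (free_module R n) N"
    and eq: "\<And>i. i < n \<Longrightarrow> f (std_basis R n i) = g (std_basis R n i)"
    and v: "v \<in> carrier (free_module R n)"
  shows "f v = g v"
proof -
  interpret R: cring R by fact
  interpret F: module R "free_module R n" using R by (rule free_module_is_module)
  note S = free_module_simps[OF R.ring_axioms, of n]
  note Fmod = F.module_axioms
  have unit: "std_basis R n i \<in> carrier (free_module R n)" for i
    by (simp add: S std_basis_def)
  have "f v = g v" if "k \<le> n" "v \<in> carrier (free_module R n)" "\<And>j. \<lbrakk>k \<le> j; j < n\<rbrakk> \<Longrightarrow> v j = \<zero>\<^bsub>R\<^esub>"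
    for k v
    using that
  proof (induction k arbitrary: v)
    case 0
    have "v = restrict v {..<n}"
      using 0(2) by (simp add: S PiE_restrict)
    also have "\<dots> = \<zero>\<^bsub>free_module R n\<^esub>"
      unfolding S by (rule restrict_ext) (simp add: 0(3))
    finally have "v = \<zero>\<^bsub>free_module R n\<^esub>" .
    then show ?case
      by (simp add: module_hom_zero[OF Fmod N f] module_hom_zero[OF Fmod N g])
  next
    case (Suc k)
    have vR: "v j \<in> carrier R" if "j < n" for j
      using Suc.prems(2) that by (auto simp: S)
    define w where "w = restrict (\<lambda>j. if j = k then \<zero>\<^bsub>R\<^esub> else v j) {..<n}"
    have w: "w \<in> carrier (free_module R n)"
      using vR by (auto simp: S w_def)
    have "f w = g w"
      using Suc.prems by (intro Suc.IH w) (auto simp: w_def)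
    have "v = w \<oplus>\<^bsub>free_module R n\<^esub> (v k \<odot>\<^bsub>free_module R n\<^esub> std_basis R n k)"
    proof -
      have "v = restrict v {..<n}"
        using Suc.prems(2) by (simp add: S PiE_restrict)
      also have "\<dots> = w \<oplus>\<^bsub>free_module R n\<^esub> (v k \<odot>\<^bsub>free_module R n\<^esub> std_basis R n k)"
        unfolding S using vR Suc.prems(1) by (intro restrict_ext) (auto simp: w_def std_basis_def)
      finally show ?thesis .
    qed
    moreover have k: "k < n" using Suc.prems(1) by simp
    ultimately show ?case
      using w vR[OF k] unit \<open>f w = g w\<close> eq[OF k] F.smult_closed[OF vR[OF k] unit]
      by (metis module_hom_add[OF f] module_hom_add[OF g] module_hom_smult[OF f] module_hom_smult[OF g])
  qed
  from this[of n v] v show ?thesis by simp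
qed

lemma free_module_hom_exists:
  assumes M: "module R M" and m: "\<And>i. i < n \<Longrightarrow> m i \<in> carrier M"
  obtains g where "g \<in> module_hom R (free_module R n) M" "\<And>i. i < n \<Longrightarrow> g (std_basis R n i) = m i"
proof -
  interpret M: module R M by fact
  note S = free_module_simps[OF M.R.ring_axioms, of n]
  define g where "g = (\<lambda>v. \<Oplus>\<^bsub>M\<^esub>i\<in>{..<n}. v i \<odot>\<^bsub>M\<^esub> m i)"
  have cl: "(\<lambda>i. v i \<odot>\<^bsub>M\<^esub> m i) \<in> {..<n} \<rightarrow> carrier M" if "v \<in> carrier (free_module R n)" for v
    using that m by (auto simp: S)
  have "g \<in> module_hom R (free_module R n) M"
    unfolding module_hom_def mem_Collect_eq
  proof (intro conjI allI impI funcsetI, goal_cases)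
    case (1 v)
    then show ?case unfolding g_def by (intro M.M.finsum_closed cl)
  next
    case (2 v w)
    then have "g (v \<oplus>\<^bsub>free_module R n\<^esub> w) = (\<Oplus>\<^bsub>M\<^esub>i\<in>{..<n}. v i \<odot>\<^bsub>M\<^esub> m i \<oplus>\<^bsub>M\<^esub> w i \<odot>\<^bsub>M\<^esub> m i)"
      unfolding g_def using m
      by (intro M.M.finsum_cong') (auto simp: S M.smult_l_distr PiE_iff)
    also have "\<dots> = g v \<oplus>\<^bsub>M\<^esub> g w"
      unfolding g_def using 2 by (intro M.M.finsum_addf cl) auto
    finally show ?case .
  next
    case (3 r v)
    then have "g (r \<odot>\<^bsub>free_module R n\<^esub> v) = (\<Oplus>\<^bsub>M\<^esub>i\<in>{..<n}. r \<odot>\<^bsub>M\<^esub> (v i \<odot>\<^bsub>M\<^esub> m i))"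
      unfolding g_def using m
      by (intro M.M.finsum_cong') (auto simp: S M.smult_assoc1 PiE_iff)
    also have "\<dots> = r \<odot>\<^bsub>M\<^esub> g v"
      unfolding g_def using 3 by (intro M.finsum_smult_ldistr[symmetric] cl) auto
    finally show ?case .
  qed
  moreover have "g (std_basis R n i) = m i" if "i < n" for i
  proof -
    have "g (std_basis R n i) = (\<Oplus>\<^bsub>M\<^esub>j\<in>{..<n}. if i = j then m j else \<zero>\<^bsub>M\<^esub>)"
      unfolding g_def using m by (intro M.M.finsum_cong') (auto simp: std_basis_def)
    also have "\<dots> = m i"
      using that m by (intro M.M.finsum_singleton) auto
    finally show ?thesis .
  qed
  ultimately show thesis by (rule that)
qed

text \<open>Lift the images of the basis vectors and extend linearly.\<close>

lemma free_module_lift: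
  assumes R: "cring R" and M: "module R M" and N: "module R N"
    and q: "q \<in> module_hom R M N" "q ` carrier M = carrier N"
    and f: "f \<in> module_hom R (free_module R n) N"
  obtains g where "g \<in> module_hom R (free_module R n) M"
    "\<And>v. v \<in> carrier (free_module R n) \<Longrightarrow> q (g v) = f v"
proof -
  interpret R: cring R by fact
  have unit: "std_basis R n i \<in> carrier (free_module R n)" for i
    by (simp add: free_module_simps[OF R.ring_axioms] std_basis_def)
  have "\<exists>m \<in> carrier M. q m = f (std_basis R n i)" for i
  proof -
    have "f (std_basis R n i) \<in> q ` carrier M"
      unfolding q(2) using module_hom_closed[OF f] unit by (rule funcset_mem)
    then show ?thesis by (metis imageE)
  qed
  then obtain m where m: "\<And>i. m i \<in> carrier M" "\<And>i. q (m i) = f (std_basis R n i)" by metis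
  obtain g where g: "g \<in> module_hom R (free_module R n) M" "\<And>i. i < n \<Longrightarrow> g (std_basis R n i) = m i"
    by (rule free_module_hom_exists[OF M, of n m, OF m(1)]) blast
  have "q (g v) = f v" if "v \<in> carrier (free_module R n)" for v
    by (rule free_module_hom_eqI[OF R N module_hom_comp[OF g(1) q(1)] f _ that]) (simp add: g(2) m(2))
  with g(1) show thesis by (rule that)
qed

section \<open>Comparison of Ext modules of the residue field\<close>

lemma cocycles_submodule:
  assumes R: "cring R" and N: "module R N"
    and d: "d n \<in> module_hom R (free_module R (b (Suc n))) (free_module R (b n))"
  shows "submodule R (cocycles R b d N n) (Hom_module R (free_module R (b n)) N)"
  unfolding cocycles_def
  by (rule kernel_is_submodule[OF Hom_module_is_module Hom_module_is_module
        precompose_hom[OF free_module_is_module d]]) (rule free_module_is_module R N)+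

text \<open>The residue field is generated by the class of \<open>1\<close>.\<close>

lemma residue_module_resolution_exists:
  assumes R: "cring R" and noeth: "noetherian_ring R" and \<mm>: "ideal \<mm> R"
  shows "\<exists>b d e. free_resolution R (quotient_module (regular_module R) \<mm>) b d e"
proof -
  interpret R: cring R by fact
  note sub = ideal_is_submodule[OF R \<mm>]
  let ?k = "quotient_module (regular_module R) \<mm>"
  interpret k: module R ?k using sub by (rule quotient_module_is_module)
  define u where "u = \<mm> +>\<^bsub>regular_module R\<^esub> \<one>\<^bsub>R\<^esub>"
  have carr: "carrier (regular_module R) = carrier R" by (simp add: regular_module_def)
  have u: "{u} \<subseteq> carrier ?k"
    by (simp add: u_def carrier_quotient_module[OF sub] carr)
  have "v \<in> k.span {u}" if v: "v \<in> carrier ?k" for v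
  proof -
    obtain r where r: "r \<in> carrier R" "v = \<mm> +>\<^bsub>regular_module R\<^esub> r"
      using v by (auto simp: carrier_quotient_module[OF sub] carr)
    have "v = r \<odot>\<^bsub>?k\<^esub> u"
      using module_hom_smult[OF coset_map_hom[OF sub] r(1), of "\<one>\<^bsub>R\<^esub>"] r
      by (simp add: u_def regular_module_def)
    then show ?thesis
      using submodule.smult_closed[OF k.span_is_submodule[OF u] r(1)] k.in_own_span[OF u] by simp
  qed
  then have "k.span {u} = carrier ?k"
    using k.span_is_subset2[OF u] by blast
  then show ?thesis
    using exists_free_resolution[OF R noeth k.module_axioms _ u] by simp
qed

text \<open>The hypothesis \<open>colon\<close> is the inclusion \<open>(xI :\<^sub>I \<mm>) \<subseteq> xR\<close>. It is what makes the
  connecting map surjective.\<close>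

locale residue_resolution = cring R for R (structure) +
  fixes \<mm> I :: "'a set" and x :: 'a and b d e
  assumes \<mm>: "maximalideal \<mm> R" and I: "ideal I R"
    and x: "x \<in> \<mm>" "nonzerodivisor R x"
    and colon: "\<And>y. \<lbrakk>y \<in> I; \<And>a. a \<in> \<mm> \<Longrightarrow> \<exists>i \<in> I. a \<otimes> y = x \<otimes> i\<rbrakk> \<Longrightarrow> \<exists>z \<in> carrier R. y = x \<otimes> z"
    and res: "free_resolution R (quotient_module (regular_module R) \<mm>) b d e"
begin

abbreviation "F i \<equiv> free_module R (b i)"
abbreviation "A \<equiv> regular_module R"
abbreviation "k \<equiv> quotient_module A \<mm>"
abbreviation "A_mod_I \<equiv> quotient_module A I"

lemma mods: "module R (F i)" "module R A" "module R k" "module R A_mod_I" "module R (ideal_module R I)"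
  using free_module_is_module[OF is_cring] regular_module_is_module[OF is_cring]
    quotient_module_is_module[OF ideal_is_submodule[OF is_cring]]
    maximalideal.axioms(1)[OF \<mm>] I ideal_module_is_module[OF is_cring I] by auto

lemma A_simps [simp]: "carrier A = carrier R" "\<zero>\<^bsub>A\<^esub> = \<zero>" "add A = add R" "r \<odot>\<^bsub>A\<^esub> s = r \<otimes> s"
  by (simp_all add: regular_module_def)

lemma e_hom: "e \<in> module_hom R (F 0) k"
  and d_hom: "d i \<in> module_hom R (F (Suc i)) (F i)"
  and im_d0: "d 0 ` carrier (F 1) = {v \<in> carrier (F 0). e v = \<zero>\<^bsub>k\<^esub>}"
  and im_d1: "d 1 ` carrier (F 2) = {v \<in> carrier (F 1). d 0 v = \<zero>\<^bsub>F 0\<^esub>}"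
  using res by (auto simp: free_resolution_def numeral_2_eq_2)

lemma xR: "x \<in> carrier R" and \<mm>R: "a \<in> \<mm> \<Longrightarrow> a \<in> carrier R" and IR: "i \<in> I \<Longrightarrow> i \<in> carrier R"
  using x \<mm> I by (auto dest: maximalideal.axioms(1) ideal.Icarr)

lemma cancel_x: "\<lbrakk>r \<in> carrier R; s \<in> carrier R; x \<otimes> r = x \<otimes> s\<rbrakk> \<Longrightarrow> r = s"
  by (rule nonzerodivisor_cancel[OF is_cring x(2)])

lemma F_smult: "\<lbrakk>r \<in> carrier R; v \<in> carrier (F i)\<rbrakk> \<Longrightarrow> r \<odot>\<^bsub>F i\<^esub> v \<in> carrier (F i)"
  and F_add: "\<lbrakk>v \<in> carrier (F i); w \<in> carrier (F i)\<rbrakk> \<Longrightarrow> v \<oplus>\<^bsub>F i\<^esub> w \<in> carrier (F i)"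
  using module.smult_closed[OF mods(1)] abelian_monoid.a_closed[OF abelian_group.axioms(1)[OF module.axioms(2)[OF mods(1)]]]
  by blast+

text \<open>\<open>\<mm>\<close> kills \<open>k\<close>, so \<open>\<mm>F\<^sub>0\<close> is contained in the kernel of \<open>F\<^sub>0 \<rightarrow> k\<close>, which is the image of \<open>F\<^sub>1\<close>.\<close>

lemma smult_maximal_in_syzygies:
  assumes a: "a \<in> \<mm>" and v: "v \<in> carrier (F 0)"
  shows "\<exists>w \<in> carrier (F 1). a \<odot>\<^bsub>F 0\<^esub> v = d 0 w"
proof -
  note sub = ideal_is_submodule[OF is_cring maximalideal.axioms(1)[OF \<mm>]]
  have "e v \<in> carrier k" using module_hom_closed[OF e_hom] v by blast
  then obtain r where r: "r \<in> carrier R" "e v = \<mm> +>\<^bsub>A\<^esub> r"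
    by (auto simp: carrier_quotient_module[OF sub])
  have "e (a \<odot>\<^bsub>F 0\<^esub> v) = a \<odot>\<^bsub>k\<^esub> (\<mm> +>\<^bsub>A\<^esub> r)"
    using module_hom_smult[OF e_hom \<mm>R[OF a] v] r(2) by simp
  also have "\<dots> = \<mm> +>\<^bsub>A\<^esub> (a \<otimes> r)"
    using module_hom_smult[OF coset_map_hom[OF sub] \<mm>R[OF a], of r] r(1) by simp
  also have "\<dots> = \<zero>\<^bsub>k\<^esub>"
    using coset_eq_zero_iff[OF sub, of "a \<otimes> r"] ideal.I_r_closed[OF maximalideal.axioms(1)[OF \<mm>] a r(1)]
      \<mm>R[OF a] r(1) by simp
  finally have "a \<odot>\<^bsub>F 0\<^esub> v \<in> d 0 ` carrier (F 1)"
    unfolding im_d0 using F_smult[OF \<mm>R[OF a] v] by simp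
  then show ?thesis by blast
qed

text \<open>The linear maps \<open>F\<^sub>0 \<rightarrow> R\<close> that lift a zero-cocycle with values in \<open>R/I\<close>.\<close>

definition lifts :: "((nat \<Rightarrow> 'a) \<Rightarrow> 'a) set" where
  "lifts = {g \<in> carrier (Hom_module R (F 0) A). \<forall>w \<in> carrier (F 1). g (d 0 w) \<in> I}"

abbreviation "L \<equiv> (Hom_module R (F 0) A)\<lparr>carrier := lifts\<rparr>"

lemma d0_closed: "w \<in> carrier (F 1) \<Longrightarrow> d 0 w \<in> carrier (F 0)"
  using module_hom_closed[OF d_hom[of 0]] by auto

lemma lifts_hom: "g \<in> lifts \<Longrightarrow> g \<in> module_hom R (F 0) A"
  and lifts_ext: "g \<in> lifts \<Longrightarrow> g \<in> extensional (carrier (F 0))"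
  and lifts_d: "\<lbrakk>g \<in> lifts; w \<in> carrier (F 1)\<rbrakk> \<Longrightarrow> g (d 0 w) \<in> I"
  by (auto simp: lifts_def Hom_module_simps)

lemma lifts_closed: "\<lbrakk>g \<in> lifts; v \<in> carrier (F 0)\<rbrakk> \<Longrightarrow> g v \<in> carrier R"
  using module_hom_closed[OF lifts_hom] by auto

lemma lifts_submodule: "submodule R lifts (Hom_module R (F 0) A)"
proof (rule submodule.intro[OF Hom_module_is_module[OF mods(1,2)]])
  interpret H: module R "Hom_module R (F 0) A" by (rule Hom_module_is_module[OF mods(1,2)])
  interpret I: ideal I R by (rule I)
  show "lifts \<subseteq> carrier (Hom_module R (F 0) A)" by (auto simp: lifts_def)
  show "f \<oplus>\<^bsub>Hom_module R (F 0) A\<^esub> g \<in> lifts" if "f \<in> lifts" "g \<in> lifts" for f g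
    using that H.M.a_closed[of f g] d0_closed unfolding lifts_def
    by (simp add: Hom_module_simps(3) I.a_closed)
  show "\<zero>\<^bsub>Hom_module R (F 0) A\<^esub> \<in> lifts"
    using H.M.zero_closed d0_closed unfolding lifts_def
    by (simp add: Hom_module_simps(2) I.zero_closed)
  show "r \<odot>\<^bsub>Hom_module R (F 0) A\<^esub> g \<in> lifts" if "r \<in> carrier R" "g \<in> lifts" for r g
    using that H.smult_closed[of r g] d0_closed unfolding lifts_def
    by (simp add: Hom_module_simps(4) I.I_l_closed)
qed

lemma L_module: "module R L"
  by (rule module.submodule_is_module[OF Hom_module_is_module[OF mods(1,2)] lifts_submodule])

lemma L_simps: "carrier L = lifts" "r \<odot>\<^bsub>L\<^esub> g = restrict (\<lambda>v. r \<otimes> g v) (carrier (F 0))"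
  by (simp_all add: Hom_module_simps)

definition reduction :: "((nat \<Rightarrow> 'a) \<Rightarrow> 'a) \<Rightarrow> (nat \<Rightarrow> 'a) \<Rightarrow> 'a set" where
  "reduction g = compose (carrier (F 0)) (\<lambda>r. I +>\<^bsub>A\<^esub> r) g"

definition restriction :: "((nat \<Rightarrow> 'a) \<Rightarrow> 'a) \<Rightarrow> (nat \<Rightarrow> 'a) \<Rightarrow> 'a" where
  "restriction g = compose (carrier (F 1)) g (d 0)"

abbreviation "Z0 \<equiv> (Hom_module R (F 0) A_mod_I)\<lparr>carrier := cocycles R b d A_mod_I 0\<rparr>"
abbreviation "Z1 \<equiv> (Hom_module R (F 1) (ideal_module R I))\<lparr>carrier := cocycles R b d (ideal_module R I) 1\<rparr>"

lemmas I_sub = ideal_is_submodule[OF is_cring I]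

lemma mem_Z0_iff: "f \<in> cocycles R b d A_mod_I 0 \<longleftrightarrow>
    f \<in> carrier (Hom_module R (F 0) A_mod_I) \<and> (\<forall>w \<in> carrier (F 1). f (d 0 w) = \<zero>\<^bsub>A_mod_I\<^esub>)"
  by (auto simp: cocycles_def Hom_module_simps(2) compose_def fun_eq_iff restrict_def split: if_splits)

lemma mem_Z1_iff: "c \<in> cocycles R b d (ideal_module R I) 1 \<longleftrightarrow>
    c \<in> carrier (Hom_module R (F 1) A) \<and> (\<forall>w \<in> carrier (F 1). c w \<in> I) \<and> (\<forall>u \<in> carrier (F 2). c (d 1 u) = \<zero>)"
proof -
  have "\<zero>\<^bsub>ideal_module R I\<^esub> = \<zero>"
    by (simp add: ideal_module_def)
  moreover have "carrier (Hom_module R (F 1) (ideal_module R I))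
      = {f \<in> carrier (Hom_module R (F 1) A). \<forall>w \<in> carrier (F 1). f w \<in> I}"
    by (simp add: Hom_ideal_module[OF I])
  ultimately show ?thesis
    by (auto simp: cocycles_def Hom_module_simps(2) compose_def fun_eq_iff restrict_def
        numeral_2_eq_2 split: if_splits)
qed

lemma reduction_hom: "reduction \<in> module_hom R L Z0"
  unfolding reduction_def
proof (rule module_hom_restrict[OF postcompose_hom[OF mods(1) coset_map_hom[OF I_sub]]])
  show "lifts \<subseteq> carrier (Hom_module R (F 0) A)" by (auto simp: lifts_def)
  fix g assume g: "g \<in> lifts"
  then have "compose (carrier (F 0)) (\<lambda>r. I +>\<^bsub>A\<^esub> r) g \<in> carrier (Hom_module R (F 0) A_mod_I)"
    using module_hom_closed[OF postcompose_hom[OF mods(1) coset_map_hom[OF I_sub]]]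
    by (auto simp: lifts_def)
  then show "compose (carrier (F 0)) (\<lambda>r. I +>\<^bsub>A\<^esub> r) g \<in> cocycles R b d A_mod_I 0"
    using g lifts_d IR by (simp add: mem_Z0_iff compose_def d0_closed coset_eq_zero_iff[OF I_sub])
qed

text \<open>A zero-cocycle with values in \<open>R/I\<close> lifts to a map into \<open>R\<close> because \<open>F\<^sub>0\<close> is free, and the cocycle
  condition says that the lift maps the syzygies into \<open>I\<close>.\<close>

lemma reduction_surj: "reduction ` carrier L = carrier Z0"
proof
  show "reduction ` carrier L \<subseteq> carrier Z0"
    using module_hom_closed[OF reduction_hom] by blast
  show "carrier Z0 \<subseteq> reduction ` carrier L"
  proof
    fix f assume "f \<in> carrier Z0"
    then have fZ: "f \<in> cocycles R b d A_mod_I 0" by simp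
    then have f: "f \<in> module_hom R (F 0) A_mod_I" "f \<in> extensional (carrier (F 0))"
      by (auto simp: mem_Z0_iff Hom_module_simps)
    obtain g where g: "g \<in> module_hom R (F 0) A" "\<And>v. v \<in> carrier (F 0) \<Longrightarrow> I +>\<^bsub>A\<^esub> g v = f v"
      by (rule free_module_lift[OF is_cring mods(2,4) coset_map_hom[OF I_sub]
            carrier_quotient_module[OF I_sub, symmetric] f(1)]) blast
    define g' where "g' = restrict g (carrier (F 0))"
    have hom: "g' \<in> module_hom R (F 0) A"
      using g(1) F_smult F_add by (simp add: g'_def module_hom_def Pi_iff)
    have "g' (d 0 w) \<in> I" if w: "w \<in> carrier (F 1)" for w
    proof -
      have "g (d 0 w) \<in> carrier A"
        using module_hom_closed[OF g(1)] d0_closed[OF w] by blast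
      moreover have "I +>\<^bsub>A\<^esub> g (d 0 w) = \<zero>\<^bsub>A_mod_I\<^esub>"
        using fZ w g(2)[OF d0_closed[OF w]] by (simp add: mem_Z0_iff)
      ultimately show ?thesis
        using coset_eq_zero_iff[OF I_sub] d0_closed[OF w] by (simp add: g'_def)
    qed
    with hom have "g' \<in> lifts" by (simp add: lifts_def Hom_module_simps g'_def)
    moreover have "f = reduction g'"
      unfolding reduction_def
      by (rule extensionalityI[OF f(2)]) (simp_all add: compose_def g'_def g(2))
    ultimately show "f \<in> reduction ` carrier L" by simp
  qed
qed

lemma restriction_hom: "restriction \<in> module_hom R L Z1"
proof -
  have "restriction \<in> module_hom R (Hom_module R (F 0) A) (Hom_module R (F 1) A)"
    unfolding restriction_def using precompose_hom[OF mods(1) d_hom[of 0]] by simp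
  then have "restriction \<in> module_hom R L ((Hom_module R (F 1) A)\<lparr>carrier := cocycles R b d (ideal_module R I) 1\<rparr>)"
  proof (rule module_hom_restrict)
    show "lifts \<subseteq> carrier (Hom_module R (F 0) A)" by (auto simp: lifts_def)
    fix g assume g: "g \<in> lifts"
    have "restriction g \<in> carrier (Hom_module R (F 1) A)"
      using module_hom_closed[OF \<open>restriction \<in> _\<close>] g by (auto simp: lifts_def)
    moreover have "restriction g w \<in> I" if "w \<in> carrier (F 1)" for w
      using that lifts_d[OF g] by (simp add: restriction_def compose_def)
    moreover have "restriction g (d 1 u) = \<zero>" if "u \<in> carrier (F 2)" for u
    proof -
      have "d 1 u \<in> carrier (F 1)" "d 0 (d 1 u) = \<zero>\<^bsub>F 0\<^esub>"
        using im_d1 that by auto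
      then show ?thesis
        using module_hom_zero[OF mods(1,2) lifts_hom[OF g]] by (simp add: restriction_def compose_def)
    qed
    ultimately show "restriction g \<in> cocycles R b d (ideal_module R I) 1"
      unfolding mem_Z1_iff by blast
  qed
  then show ?thesis
    by (simp add: Hom_ideal_module[OF I])
qed

text \<open>A one-cocycle \<open>c : F\<^sub>1 \<rightarrow> I\<close> factors through the syzygies as some \<open>c'\<close>, and the task is to extend \<open>c'\<close>
  to a map \<open>g : F\<^sub>0 \<rightarrow> R\<close>. Since \<open>xF\<^sub>0\<close> consists of syzygies, \<open>v \<mapsto> c'(xv)\<close> is defined on all of \<open>F\<^sub>0\<close>, and the
  extension has to be this map divided by \<open>x\<close>. For \<open>a \<in> \<mm>\<close> also \<open>av\<close> is a syzygy, so
  \<open>a c'(xv) = x c'(av) \<in> xI\<close>. Thus \<open>c'(xv)\<close> lies in \<open>(xI :\<^sub>I \<mm>)\<close>, and the division is possible.\<close>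

lemma restriction_surj: "restriction ` carrier L = carrier Z1"
proof
  show "restriction ` carrier L \<subseteq> carrier Z1"
    using module_hom_closed[OF restriction_hom] by blast
  show "carrier Z1 \<subseteq> restriction ` carrier L"
  proof
    fix c assume "c \<in> carrier Z1"
    then have cZ: "c \<in> cocycles R b d (ideal_module R I) 1" by simp
    then have c: "c \<in> module_hom R (F 1) A" "c \<in> extensional (carrier (F 1))"
      and cI: "\<And>w. w \<in> carrier (F 1) \<Longrightarrow> c w \<in> I"
      and cd: "\<And>u. u \<in> carrier (F 2) \<Longrightarrow> c (d 1 u) = \<zero>"
      unfolding mem_Z1_iff Hom_module_simps by auto
    \<comment> \<open>so \<open>c\<close> induces the map \<open>c'\<close> on the syzygies\<close>
    have c_eq: "c w = c w'" if w: "w \<in> carrier (F 1)" "w' \<in> carrier (F 1)" "d 0 w = d 0 w'" for w w'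
    proof -
      interpret F1: module R "F 1" by (rule mods)
      interpret F0: module R "F 0" by (rule mods)
      have "d 0 (w \<ominus>\<^bsub>F 1\<^esub> w') = \<zero>\<^bsub>F 0\<^esub>"
        using module_hom_minus[OF mods(1,1) d_hom[of 0]] w d0_closed by simp
      then have "w \<ominus>\<^bsub>F 1\<^esub> w' \<in> d 1 ` carrier (F 2)"
        unfolding im_d1 using F1.M.minus_closed[OF w(1,2)] by blast
      then have "c (w \<ominus>\<^bsub>F 1\<^esub> w') = \<zero>" using cd by auto
      then have "c w \<ominus>\<^bsub>A\<^esub> c w' = \<zero>\<^bsub>A\<^esub>"
        using module_hom_minus[OF mods(1,2) c(1) w(1,2)] by simp
      moreover have "c w \<in> carrier A" "c w' \<in> carrier A"
        using cI w IR by auto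
      ultimately show ?thesis
        using abelian_group.minus_other_side[OF module.axioms(2)[OF mods(2)]] by blast
    qed
    have "\<exists>w. \<forall>v \<in> carrier (F 0). w v \<in> carrier (F 1) \<and> d 0 (w v) = x \<odot>\<^bsub>F 0\<^esub> v"
      using smult_maximal_in_syzygies[OF x(1)] by (intro bchoice) metis
    \<comment> \<open>\<open>c (w v)\<close> stands for \<open>c'(xv)\<close>\<close>
    then obtain w where w: "\<And>v. v \<in> carrier (F 0) \<Longrightarrow> w v \<in> carrier (F 1)"
      "\<And>v. v \<in> carrier (F 0) \<Longrightarrow> d 0 (w v) = x \<odot>\<^bsub>F 0\<^esub> v" by blast
    note [simp del] = One_nat_def
    note d_add = module_hom_add[OF d_hom[of 0], unfolded One_nat_def[symmetric]]
    note d_smult = module_hom_smult[OF d_hom[of 0], unfolded One_nat_def[symmetric]]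
    interpret F0: module R "F 0" by (rule mods)
    have c_smult: "c (w (a \<odot>\<^bsub>F 0\<^esub> v)) = a \<otimes> c (w v)" if a: "a \<in> carrier R" and v: "v \<in> carrier (F 0)" for a v
    proof -
      have "c (w (a \<odot>\<^bsub>F 0\<^esub> v)) = c (a \<odot>\<^bsub>F 1\<^esub> w v)"
        using a v by (intro c_eq)
          (simp_all add: w F_smult d_smult F0.smult_assoc_simp xR m_comm)
      then show ?thesis
        using module_hom_smult[OF c(1) a w(1)[OF v]] by simp
    qed
    have c_add: "c (w (v \<oplus>\<^bsub>F 0\<^esub> v')) = c (w v) \<oplus> c (w v')"
      if v: "v \<in> carrier (F 0)" "v' \<in> carrier (F 0)" for v v'
    proof -
      have "c (w (v \<oplus>\<^bsub>F 0\<^esub> v')) = c (w v \<oplus>\<^bsub>F 1\<^esub> w v')"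
        using v by (intro c_eq) (simp_all add: w F_add d_add F0.smult_r_distr xR)
      then show ?thesis
        using module_hom_add[OF c(1) w(1)[OF v(1)] w(1)[OF v(2)]] by simp
    qed
    \<comment> \<open>on a syzygy \<open>u'\<close>, the map \<open>v \<mapsto> c'(xv)\<close> is \<open>x c'(u')\<close>, so dividing by \<open>x\<close> gives back \<open>c'\<close>\<close>
    have c_d: "c (w (d 0 u)) = x \<otimes> c u" if u: "u \<in> carrier (F 1)" for u
    proof -
      have "c (w (d 0 u)) = c (x \<odot>\<^bsub>F 1\<^esub> u)"
        using u by (intro c_eq) (simp_all add: w F_smult d_smult d0_closed xR)
      then show ?thesis
        using module_hom_smult[OF c(1) xR u] by simp
    qed
    have "\<exists>z \<in> carrier R. c (w v) = x \<otimes> z" if v: "v \<in> carrier (F 0)" for v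
    proof (rule colon[OF cI[OF w(1)[OF v]]])
      fix a assume a: "a \<in> \<mm>"
      obtain u where u: "u \<in> carrier (F 1)" "a \<odot>\<^bsub>F 0\<^esub> v = d 0 u"
        using smult_maximal_in_syzygies[OF a v] by blast
      then have "a \<otimes> c (w v) = x \<otimes> c u"
        using c_smult[OF \<mm>R[OF a] v] c_d[OF u(1)] by simp
      then show "\<exists>i \<in> I. a \<otimes> c (w v) = x \<otimes> i" using cI[OF u(1)] by blast
    qed
    then obtain g where g: "\<And>v. v \<in> carrier (F 0) \<Longrightarrow> g v \<in> carrier R"
      "\<And>v. v \<in> carrier (F 0) \<Longrightarrow> c (w v) = x \<otimes> g v" by metis
    define g' where "g' = restrict g (carrier (F 0))"
    have g_d: "g (d 0 u) = c u" if "u \<in> carrier (F 1)" for u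
      using g[OF d0_closed[OF that]] c_d[OF that] IR[OF cI[OF that]] by (simp add: cancel_x)
    have "g' \<in> module_hom R (F 0) A"
      unfolding module_hom_def mem_Collect_eq
    proof (intro conjI allI impI funcsetI, goal_cases)
      case (1 v)
      then show ?case by (simp add: g'_def g(1))
    next
      case (2 v v')
      then have v: "v \<in> carrier (F 0)" "v' \<in> carrier (F 0)" by auto
      have "g (v \<oplus>\<^bsub>F 0\<^esub> v') = g v \<oplus> g v'"
      proof (rule cancel_x)
        show "x \<otimes> g (v \<oplus>\<^bsub>F 0\<^esub> v') = x \<otimes> (g v \<oplus> g v')"
          using c_add[OF v] v by (simp add: g F_add r_distr xR)
      qed (simp_all add: g v F_add)
      then show ?case using v by (simp add: g'_def F_add)
    next
      case (3 r v)
      then have v: "r \<in> carrier R" "v \<in> carrier (F 0)" by auto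
      have "g (r \<odot>\<^bsub>F 0\<^esub> v) = r \<otimes> g v"
      proof (rule cancel_x)
        show "x \<otimes> g (r \<odot>\<^bsub>F 0\<^esub> v) = x \<otimes> (r \<otimes> g v)"
          using c_smult[OF v] v by (simp add: g F_smult xR m_lcomm)
      qed (simp_all add: g v F_smult)
      then show ?case using v by (simp add: g'_def F_smult)
    qed
    then have "g' \<in> lifts"
      by (simp add: lifts_def Hom_module_simps g'_def d0_closed g_d cI)
    moreover have "c = restriction g'"
      unfolding restriction_def
      by (rule extensionalityI[OF c(2)]) (simp_all add: compose_def g'_def d0_closed g_d)
    ultimately show "c \<in> restriction ` carrier L" by simp
  qed
qed

lemma reduction_coboundary_iff:
  assumes g: "g \<in> lifts"
  shows "reduction g \<in> coboundaries R b d A_mod_I 0 \<longleftrightarrow> (\<forall>v \<in> carrier (F 0). g v \<in> I)"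
proof -
  have "reduction g \<in> coboundaries R b d A_mod_I 0 \<longleftrightarrow> (\<forall>v \<in> carrier (F 0). I +>\<^bsub>A\<^esub> g v = \<zero>\<^bsub>A_mod_I\<^esub>)"
    by (auto simp: coboundaries_def reduction_def compose_def Hom_module_simps(2) fun_eq_iff restrict_def)
  also have "\<dots> \<longleftrightarrow> (\<forall>v \<in> carrier (F 0). g v \<in> I)"
    using coset_eq_zero_iff[OF I_sub] lifts_closed[OF g] by simp
  finally show ?thesis .
qed

text \<open>If \<open>g\<close> and some \<open>h : F\<^sub>0 \<rightarrow> I\<close> agree on the syzygies, they agree on \<open>xF\<^sub>0\<close>, and hence everywhere
  because \<open>x\<close> is a nonzerodivisor. This is where \<open>Hom(k, R) = 0\<close> enters.\<close>

lemma restriction_coboundary_iff: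
  assumes g: "g \<in> lifts"
  shows "restriction g \<in> coboundaries R b d (ideal_module R I) 1 \<longleftrightarrow> (\<forall>v \<in> carrier (F 0). g v \<in> I)"
proof
  assume "\<forall>v \<in> carrier (F 0). g v \<in> I"
  then have "g \<in> carrier (Hom_module R (F 0) (ideal_module R I))"
    using g by (simp add: Hom_ideal_module[OF I] lifts_def)
  then show "restriction g \<in> coboundaries R b d (ideal_module R I) 1"
    by (auto simp: coboundaries_def restriction_def)
next
  assume "restriction g \<in> coboundaries R b d (ideal_module R I) 1"
  then obtain h where h: "h \<in> carrier (Hom_module R (F 0) (ideal_module R I))"
    "restriction g = compose (carrier (F 1)) h (d 0)"
    by (auto simp: coboundaries_def)
  then have hI: "\<And>v. v \<in> carrier (F 0) \<Longrightarrow> h v \<in> I" and hom: "h \<in> module_hom R (F 0) A"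
    by (simp_all add: Hom_ideal_module[OF I] Hom_module_simps)
  have eq: "g (d 0 u) = h (d 0 u)" if "u \<in> carrier (F 1)" for u
    using fun_cong[OF h(2), of u] that by (simp add: restriction_def compose_def)
  have "g v = h v" if v: "v \<in> carrier (F 0)" for v
  proof (rule cancel_x)
    obtain u where u: "u \<in> carrier (F 1)" "x \<odot>\<^bsub>F 0\<^esub> v = d 0 u"
      using smult_maximal_in_syzygies[OF x(1) v] by blast
    then show "x \<otimes> g v = x \<otimes> h v"
      using module_hom_smult[OF lifts_hom[OF g] xR v] module_hom_smult[OF hom xR v] eq[OF u(1)] by simp
  qed (use v g hI IR lifts_closed in auto)
  with hI show "\<forall>v \<in> carrier (F 0). g v \<in> I" by simp
qed

lemma Z0_module: "module R Z0" and Z1_module: "module R Z1"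
  using module.submodule_is_module[OF Hom_module_is_module[OF mods(1,4)] cocycles_submodule[where b=b and d=d and n=0, OF is_cring mods(4) d_hom]]
    module.submodule_is_module[OF Hom_module_is_module[OF mods(1,5)] cocycles_submodule[where b=b and d=d and n=1, OF is_cring mods(5) d_hom]]
  by auto

lemma B0_submodule: "submodule R (coboundaries R b d A_mod_I 0) Z0"
  using zero_submodule[OF Z0_module] by (simp add: coboundaries_def)

lemma B1_submodule: "submodule R (coboundaries R b d (ideal_module R I) 1) Z1"
proof (rule submodule_of_submodule)
  show "submodule R (cocycles R b d (ideal_module R I) 1) (Hom_module R (F 1) (ideal_module R I))"
    using cocycles_submodule[where b=b and d=d and n=1, OF is_cring mods(5) d_hom] by simp
  have "(\<lambda>f. compose (carrier (F 1)) f (d 0)) ` carrier (Hom_module R (F 0) (ideal_module R I))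
      = coboundaries R b d (ideal_module R I) 1"
    by (simp add: coboundaries_def)
  then show "submodule R (coboundaries R b d (ideal_module R I) 1) (Hom_module R (F 1) (ideal_module R I))"
    using image_is_submodule[OF Hom_module_is_module[OF mods(1,5)] Hom_module_is_module[OF mods(1,5)]
        precompose_hom[OF mods(1) d_hom[of 0], where N="ideal_module R I"]] by simp
  show "coboundaries R b d (ideal_module R I) 1 \<subseteq> cocycles R b d (ideal_module R I) 1"
  proof
    fix c assume "c \<in> coboundaries R b d (ideal_module R I) 1"
    then obtain h where h: "h \<in> carrier (Hom_module R (F 0) (ideal_module R I))"
      "c = restriction h"
      by (auto simp: coboundaries_def restriction_def)
    then have "h \<in> lifts"
      by (simp add: Hom_ideal_module[OF I] lifts_def d0_closed)
    then show "c \<in> cocycles R b d (ideal_module R I) 1"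
      using module_hom_closed[OF restriction_hom] h(2) by auto
  qed
qed

text \<open>\<open>Ext\<^sup>1(k, I)\<close> and \<open>Hom(k, R/I)\<close> have the same dimension: both are the module of lifts modulo the maps
  with all values in \<open>I\<close>.\<close>

lemma dim_Ext_eq:
  "vectorspace.dim (R Quot \<mm>) (residue_vectorspace (cohomology R b d (ideal_module R I) 1))
   = vectorspace.dim (R Quot \<mm>) (residue_vectorspace (cohomology R b d A_mod_I 0))"
proof -
  define f where "f = (\<lambda>g. coboundaries R b d A_mod_I 0 +>\<^bsub>Z0\<^esub> reduction g)"
  define h where "h = (\<lambda>g. coboundaries R b d (ideal_module R I) 1 +>\<^bsub>Z1\<^esub> restriction g)"
  have coh: "cohomology R b d A_mod_I 0 = quotient_module Z0 (coboundaries R b d A_mod_I 0)"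
    "cohomology R b d (ideal_module R I) 1 = quotient_module Z1 (coboundaries R b d (ideal_module R I) 1)"
    by (simp_all add: cohomology_def)
  have fh_hom: "f \<in> module_hom R L (cohomology R b d A_mod_I 0)"
    "h \<in> module_hom R L (cohomology R b d (ideal_module R I) 1)"
    unfolding coh f_def h_def
    by (rule module_hom_comp[OF reduction_hom coset_map_hom[OF B0_submodule]],
        rule module_hom_comp[OF restriction_hom coset_map_hom[OF B1_submodule]])
  have f_zero: "f g = \<zero>\<^bsub>cohomology R b d A_mod_I 0\<^esub> \<longleftrightarrow> (\<forall>v \<in> carrier (F 0). g v \<in> I)" if "g \<in> lifts" for g
    unfolding coh f_def
    using coset_eq_zero_iff[OF B0_submodule, of "reduction g"] module_hom_closed[OF reduction_hom]
      reduction_coboundary_iff that by auto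
  have h_zero: "h g = \<zero>\<^bsub>cohomology R b d (ideal_module R I) 1\<^esub> \<longleftrightarrow> (\<forall>v \<in> carrier (F 0). g v \<in> I)"
    if "g \<in> lifts" for g
    unfolding coh h_def
    using coset_eq_zero_iff[OF B1_submodule, of "restriction g"] module_hom_closed[OF restriction_hom]
      restriction_coboundary_iff that by auto
  have "vectorspace.dim (R Quot \<mm>) (residue_vectorspace (cohomology R b d A_mod_I 0))
    = vectorspace.dim (R Quot \<mm>) (residue_vectorspace (cohomology R b d (ideal_module R I) 1))"
  proof (rule dim_residue_vectorspace_eq[OF is_cring \<mm> L_module])
    show "module R (cohomology R b d A_mod_I 0)" "module R (cohomology R b d (ideal_module R I) 1)"
      unfolding coh by (rule quotient_module_is_module[OF B0_submodule], rule quotient_module_is_module[OF B1_submodule])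
    show "f ` carrier L = carrier (cohomology R b d A_mod_I 0)"
      unfolding coh f_def carrier_quotient_module[OF B0_submodule] reduction_surj[symmetric] by (simp add: image_image)
    show "h ` carrier L = carrier (cohomology R b d (ideal_module R I) 1)"
      unfolding coh h_def carrier_quotient_module[OF B1_submodule] restriction_surj[symmetric] by (simp add: image_image)
    show "f g = \<zero>\<^bsub>cohomology R b d A_mod_I 0\<^esub> \<longleftrightarrow> h g = \<zero>\<^bsub>cohomology R b d (ideal_module R I) 1\<^esub>"
      if "g \<in> carrier L" for g
      using that f_zero h_zero by simp
    fix r g assume r: "r \<in> \<mm>" and "g \<in> carrier L"
    then have g: "g \<in> lifts" by simp
    have rg: "r \<odot>\<^bsub>L\<^esub> g \<in> lifts"
      using module.smult_closed[OF L_module \<mm>R[OF r], of g] g by simp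
    have "(r \<odot>\<^bsub>L\<^esub> g) v \<in> I" if v: "v \<in> carrier (F 0)" for v
    proof -
      obtain u where u: "u \<in> carrier (F 1)" "r \<odot>\<^bsub>F 0\<^esub> v = d 0 u"
        using smult_maximal_in_syzygies[OF r v] by blast
      have "(r \<odot>\<^bsub>L\<^esub> g) v = g (d 0 u)"
        unfolding u(2)[symmetric] L_simps(2) using v module_hom_smult[OF lifts_hom[OF g] \<mm>R[OF r] v] by simp
      then show ?thesis using lifts_d[OF g u(1)] by simp
    qed
    then show "f (r \<odot>\<^bsub>L\<^esub> g) = \<zero>\<^bsub>cohomology R b d A_mod_I 0\<^esub>"
      using f_zero[OF rg] by blast
  qed (rule fh_hom)+
  then show ?thesis by (rule sym)
qed

end

section \<open>Elias ideals\<close>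

theorem corollary3p15:
  fixes R :: "('a, 'b) ring_scheme" and \<mm> I J :: "'a set" and x :: 'a
  assumes "noetherian_local_ring R \<mm>"
    and "cohen_macaulay R \<mm>"
    and "krull_dim R = 1"
    and "ideal I R"
    and "ideal J R"
    and "primary_to R \<mm> I"
    and "x \<in> \<mm>"
    and "nonzerodivisor R x"
    and "I \<cdot>\<^bsub>R\<^esub> J \<subseteq> PIdl\<^bsub>R\<^esub> x"
    and "x \<in> J \<cdot>\<^bsub>R\<^esub> \<mm>"
  shows "elias_ideal R \<mm> I"
proof -
  note R = noetherian_local_ring.axioms(1)[OF assms(1)]
    and noeth = noetherian_local_ring.axioms(2)[OF assms(1)]
    and \<mm> = noetherian_local_ring.maximal[OF assms(1)]
  note \<mm>_ideal = maximalideal.axioms(1)[OF \<mm>]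
  let ?k = "quotient_module (regular_module R) \<mm>"
  \<comment> \<open>both Ext modules are computed from this one resolution\<close>
  obtain b d where bd: "(SOME (b, d). \<exists>e. free_resolution R ?k b d e) = (b, d)"
    by (metis prod.exhaust)
  have "\<exists>bd. case bd of (b, d) \<Rightarrow> \<exists>e. free_resolution R ?k b d e"
    using residue_module_resolution_exists[OF R noeth \<mm>_ideal] by auto
  from someI_ex[OF this] obtain e where res: "free_resolution R ?k b d e"
    unfolding bd by auto
  interpret residue_resolution R \<mm> I x b d e
    using R
  proof (rule residue_resolution.intro, intro residue_resolution_axioms.intro)
    show "\<exists>z \<in> carrier R. y = x \<otimes>\<^bsub>R\<^esub> z"
      if "y \<in> I" "\<And>a. a \<in> \<mm> \<Longrightarrow> \<exists>i \<in> I. a \<otimes>\<^bsub>R\<^esub> y = x \<otimes>\<^bsub>R\<^esub> i" for y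
      using mem_multiples_of_colon_multiples[OF R assms(4,5) \<mm>_ideal assms(8,10,9)] that by blast
  qed (rule \<mm> assms res)+
  have Ext: "Ext R n ?k M = cohomology R b d M n" for n and M :: "('a, 'z) module"
    by (simp add: Ext_def bd)
  obtain n :: nat where "x [^]\<^bsub>R\<^esub> n \<in> I"
    using assms(6,7) by (auto simp: primary_to_def radical_def)
  then have "module_dim R (ideal_module R I) = 1"
    using annihilator_ideal_module[OF R assms(4,8)] krull_dim_quotient_by_zero[OF R] assms(3)
    by (simp add: module_dim_def)
  moreover have "module_dim R (quotient_module (regular_module R) I) = 0"
    using krull_dim_quotient_by_primary_of_maximal[OF R \<mm> assms(6)]
    by (simp add: module_dim_def annihilator_quotient_module[OF R assms(4)])
  ultimately show ?thesis
    using dim_Ext_eq by (simp add: elias_ideal_def module_type_def Ext one_enat_def zero_enat_def)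
qed

end
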